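(* Let $\mathcal{R}$, its topology $\mathcal{T}$ and the collection of maps $\mathcal{A}$ be as defined in the context (the Riemann surface for the matricial square root). Then $(\mathcal{R},\mathcal{T},\mathcal{A})$ is a free manifold (of dimension $1$).
   Context: **Basics.** $\mathbb{M}_n$ is the algebra of $n\times n$ complex matrices, $\mathbb{M}^d=\bigcup_{n\ge1}\mathbb{M}_n^d$ (disjoint union). Direct sums and similarities are taken componentwise. An *nc-set* is a subset of $\mathbb{M}^d$ closed under direct sums. A function $f:D\to\mathbb{M}^1$ is *graded* if $f(x)\in\mathbb{M}_n$ whenever $x\in D\cap\mathbb{M}_n^d$. An *nc-function* is a graded function $f$ on an nc-set $D$ such that $f(x\oplus y)=f(x)\oplus f(y)$, and $f(s^{-1}xs)=s^{-1}f(x)s$ whenever $x\in D\cap\mathbb{M}_n^d$, $s\in\mathbb{M}_n$ is invertible and $s^{-1}xs\in D$. An *nc-mapping* is a map between nc-sets whose components are nc-functions. The *free topology* on $\mathbb{M}^d$ has as base the sets $B_\delta=\{x:\|[\delta_{ij}(x)]\|<1\}$, $\delta$ a (rectangular) matrix of free polynomials (polynomials over $\mathbb{C}$ in non-commuting variables); freely open sets are called free domains. A graded function $f$ on a free domain $D$ is *freely holomorphic* if every $x\in D$ has a freely open neighborhood $U\subseteq D$ that is an nc-set on which $f$ is an nc-function, and a free neighborhood on which $f$ is bounded. **Free manifolds.** A $d$-dimensional free manifold is a triple $(X,\mathcal{T},\mathcal{A})$ where $(X,\mathcal{T})$ is a topological space and $\mathcal{A}$ is a collection of homeomorphisms $\alpha:U_\alpha\to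 D_\alpha$, with $U_\alpha\in\mathcal{T}$ and $D_\alpha\subseteq\mathbb{M}^d$ a freely open nc-set with the free topology, such that $\bigcup_\alpha U_\alpha=X$ and, for all $\alpha,\beta\in\mathcal{A}$, $\alpha(U_\alpha\cap U_\beta)$ is a union of nc-sets and the restriction of $\beta\circ\alpha^{-1}$ to every nc-subset of $\alpha(U_\alpha\cap U_\beta)$ is an nc-mapping. **The Riemann surface.** $\mathcal{I}$ is the set of nonsingular matrices in $\mathbb{M}^1$. Let $S$ be the collection of pairs $(f,U)$ where $U=B_\delta\subseteq\mathcal{I}$ for some matrix $\delta$ of free polynomials in one variable and $f$ is a freely holomorphic function on $U$ with $f(x)^2=x$ for all $x\in U$. Let $\mathrm{graph}(f,U)=\{(x,f(x)):x\in U\}$ and $\mathcal{R}=\bigcup_{(f,U)\in S}\mathrm{graph}(f,U)$. $\mathcal{T}$ is the (unique) topology on $\mathcal{R}$ with base $\{\mathrm{graph}(f,U):(f,U)\in S\}$. $\mathcal{A}$ is the collection of maps $\alpha_{(f,U)}:\mathrm{graph}(f,U)\to U$, $\alpha_{(f,U)}(x,f(x))=x$, for $(f,U)\in S$. *)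

theory Defs
  imports
    "HOL-Analysis.Abstract_Topology"
    "HOL-Analysis.L2_Norm"
    "HOL-Library.Poly_Mapping"
    "Jordan_Normal_Form.Matrix"
begin

text \<open>
  A point of the d-dimensional nc-universe is a list of d square complex matrices of one common
  size \<open>n \<ge> 1\<close>. For \<open>d \<ge> 1\<close> the size can be read off from the point, so the union over n is
  disjoint. Functions with values in the one-dimensional universe are rendered as matrix-valued
  functions; only their values on the domain under consideration matter.
\<close>

type_synonym nc_point = "complex mat list"

definition nc_level :: "nat \<Rightarrow> nat \<Rightarrow> nc_point set" where
  "nc_level d n = {x. length x = d \<and> set x \<subseteq> carrier_mat n n}"

definition nc_universe :: "nat \<Rightarrow> nc_point set" where
  "nc_universe d = (\<Union>n\<in>{1..}. nc_level d n)"

definition nc_size :: "nc_point \<Rightarrow> nat" where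
  "nc_size x = dim_row (hd x)"

definition mat_dsum :: "complex mat \<Rightarrow> complex mat \<Rightarrow> complex mat" where
  "mat_dsum A B =
     four_block_mat A (0\<^sub>m (dim_row A) (dim_col B)) (0\<^sub>m (dim_row B) (dim_col A)) B"

definition nc_dsum :: "nc_point \<Rightarrow> nc_point \<Rightarrow> nc_point" where
  "nc_dsum x y = map2 mat_dsum x y"

definition nc_set :: "nat \<Rightarrow> nc_point set \<Rightarrow> bool" where
  "nc_set d D \<longleftrightarrow> D \<subseteq> nc_universe d \<and> (\<forall>x\<in>D. \<forall>y\<in>D. nc_dsum x y \<in> D)"

definition graded :: "nat \<Rightarrow> nc_point set \<Rightarrow> (nc_point \<Rightarrow> complex mat) \<Rightarrow> bool" where
  "graded d D f \<longleftrightarrow> (\<forall>n\<ge>1. \<forall>x \<in> D \<inter> nc_level d n. f x \<in> carrier_mat n n)"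

definition nc_function :: "nat \<Rightarrow> nc_point set \<Rightarrow> (nc_point \<Rightarrow> complex mat) \<Rightarrow> bool" where
  "nc_function d D f \<longleftrightarrow>
     nc_set d D \<and> graded d D f \<and>
     (\<forall>x\<in>D. \<forall>y\<in>D. f (nc_dsum x y) = mat_dsum (f x) (f y)) \<and>
     (\<forall>n\<ge>1. \<forall>x \<in> D \<inter> nc_level d n. \<forall>s\<in>carrier_mat n n. \<forall>t\<in>carrier_mat n n.
        inverts_mat s t \<and> inverts_mat t s \<and> map (\<lambda>a. t * a * s) x \<in> D
        \<longrightarrow> f (map (\<lambda>a. t * a * s) x) = t * f x * s)"

definition nc_mapping ::
    "nat \<Rightarrow> nat \<Rightarrow> nc_point set \<Rightarrow> nc_point set \<Rightarrow> (nc_point \<Rightarrow> nc_point) \<Rightarrow> bool" where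
  "nc_mapping d e D E \<phi> \<longleftrightarrow>
     nc_set d D \<and> nc_set e E \<and> \<phi> ` D \<subseteq> E \<and> (\<forall>i<e. nc_function d D (\<lambda>x. \<phi> x ! i))"

text \<open>
  A free polynomial is a finitely supported family of complex coefficients indexed by words; a word
  is the list of the indices of its letters.
\<close>

type_synonym free_poly = "nat list \<Rightarrow>\<^sub>0 complex"

definition free_poly_vars :: "nat \<Rightarrow> free_poly \<Rightarrow> bool" where
  "free_poly_vars d p \<longleftrightarrow> (\<forall>w\<in>Poly_Mapping.keys p. set w \<subseteq> {..<d})"

definition word_eval :: "nc_point \<Rightarrow> nat list \<Rightarrow> complex mat" where
  "word_eval x w = foldr (\<lambda>i A. x ! i * A) w (1\<^sub>m (nc_size x))"

definition free_poly_eval :: "nc_point \<Rightarrow> free_poly \<Rightarrow> complex mat" where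
  "free_poly_eval x p =
     mat (nc_size x) (nc_size x) (\<lambda>(i, j). \<Sum>w\<in>Poly_Mapping.keys p. Poly_Mapping.lookup p w * word_eval x w $$ (i, j))"

text \<open>The block matrix \<open>[\<delta>\<^sub>i\<^sub>j(x)]\<close>, whose blocks all have the size of \<open>x\<close>.\<close>

definition free_poly_mat_eval :: "free_poly mat \<Rightarrow> nc_point \<Rightarrow> complex mat" where
  "free_poly_mat_eval \<delta> x =
     (let n = nc_size x in
      mat (dim_row \<delta> * n) (dim_col \<delta> * n)
        (\<lambda>(r, c). free_poly_eval x (\<delta> $$ (r div n, c div n)) $$ (r mod n, c mod n)))"

definition vec_l2_norm :: "complex vec \<Rightarrow> real" where
  "vec_l2_norm v = L2_set (\<lambda>i. cmod (v $ i)) {..<dim_vec v}"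

definition mat_op_norm :: "complex mat \<Rightarrow> real" where
  "mat_op_norm A =
     (SUP v\<in>{v \<in> carrier_vec (dim_col A). vec_l2_norm v \<le> 1}. vec_l2_norm (A *\<^sub>v v))"

definition free_poly_mat :: "nat \<Rightarrow> free_poly mat \<Rightarrow> bool" where
  "free_poly_mat d \<delta> \<longleftrightarrow>
     0 < dim_row \<delta> \<and> 0 < dim_col \<delta> \<and> (\<forall>p\<in>elements_mat \<delta>. free_poly_vars d p)"

definition basic_free_set :: "nat \<Rightarrow> free_poly mat \<Rightarrow> nc_point set" where
  "basic_free_set d \<delta> = {x \<in> nc_universe d. mat_op_norm (free_poly_mat_eval \<delta> x) < 1}"

text \<open>
  The topology with a given base consists of the arbitrary unions of members of that base.
  Since \<^const>\<open>topology\<close> is meaningful only for such families that form a topology, the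
  fact that the sets in question do form a base is not built into the definition.
\<close>

definition topology_with_base :: "'a set set \<Rightarrow> 'a topology" where
  "topology_with_base \<B> = topology (arbitrary union_of (\<lambda>B. B \<in> \<B>))"

definition free_topology :: "nat \<Rightarrow> nc_point topology" where
  "free_topology d = topology_with_base {basic_free_set d \<delta> |\<delta>. free_poly_mat d \<delta>}"

definition freely_holomorphic ::
    "nat \<Rightarrow> nc_point set \<Rightarrow> (nc_point \<Rightarrow> complex mat) \<Rightarrow> bool" where
  "freely_holomorphic d D f \<longleftrightarrow>
     openin (free_topology d) D \<and> graded d D f \<and>
     (\<forall>x\<in>D.
        (\<exists>U. openin (free_topology d) U \<and> x \<in> U \<and> U \<subseteq> D \<and> nc_function d U f) \<and>
        (\<exists>V. openin (free_topology d) V \<and> x \<in> V \<and> V \<subseteq> D \<and>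
             (\<exists>C. \<forall>y\<in>V. mat_op_norm (f y) \<le> C)))"

text \<open>
  A chart \<open>\<alpha> : U \<rightarrow> D\<close> is encoded as the triple of its domain, its underlying function (only the
  values on the domain matter) and its range.
\<close>

type_synonym 'a free_chart = "'a set \<times> ('a \<Rightarrow> nc_point) \<times> nc_point set"

definition free_manifold :: "nat \<Rightarrow> 'a set \<Rightarrow> 'a topology \<Rightarrow> 'a free_chart set \<Rightarrow> bool" where
  "free_manifold d X T \<A> \<longleftrightarrow>
     1 \<le> d \<and> topspace T = X \<and>
     (\<forall>(U, \<alpha>, D)\<in>\<A>.
        openin T U \<and> openin (free_topology d) D \<and> nc_set d D \<and>
        homeomorphic_map (subtopology T U) (subtopology (free_topology d) D) \<alpha>) \<and>
     (\<Union>(U, \<alpha>, D)\<in>\<A>. U) = X \<and>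
     (\<forall>(U, \<alpha>, D)\<in>\<A>. \<forall>(V, \<beta>, E)\<in>\<A>.
        (\<exists>\<C>. (\<forall>C\<in>\<C>. nc_set d C) \<and> \<Union>\<C> = \<alpha> ` (U \<inter> V)) \<and>
        (\<forall>C. nc_set d C \<and> C \<subseteq> \<alpha> ` (U \<inter> V) \<longrightarrow> nc_mapping d d C E (\<beta> \<circ> inv_into U \<alpha>)))"

definition nonsingular_points :: "nc_point set" where
  "nonsingular_points = {x \<in> nc_universe 1. invertible_mat (x ! 0)}"

definition sqrt_branches :: "((nc_point \<Rightarrow> complex mat) \<times> nc_point set) set" where
  "sqrt_branches =
     {(f, U). (\<exists>\<delta>. free_poly_mat 1 \<delta> \<and> U = basic_free_set 1 \<delta>) \<and> U \<subseteq> nonsingular_points \<and>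
              freely_holomorphic 1 U f \<and> (\<forall>x\<in>U. f x * f x = x ! 0)}"

definition graph_on :: "(nc_point \<Rightarrow> complex mat) \<Rightarrow> nc_point set \<Rightarrow> (nc_point \<times> complex mat) set"
  where "graph_on f U = {(x, f x) |x. x \<in> U}"

definition sqrt_surface :: "(nc_point \<times> complex mat) set" where
  "sqrt_surface = (\<Union>(f, U)\<in>sqrt_branches. graph_on f U)"

definition sqrt_topology :: "(nc_point \<times> complex mat) topology" where
  "sqrt_topology = topology_with_base {graph_on f U |f U. (f, U) \<in> sqrt_branches}"

definition sqrt_atlas :: "(nc_point \<times> complex mat) free_chart set" where
  "sqrt_atlas = {(graph_on f U, fst, U) |f U. (f, U) \<in> sqrt_branches}"

end

theory Submission
  imports Defs "Jordan_Normal_Form.Schur_Decomposition"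
begin

text \<open>
  Everything rests on one fact: two square root branches that agree at a point \<open>x\<close> agree on a free
  neighbourhood of \<open>x\<close>. Nc-functions respect intertwining matrices, so \<open>f(y)\<close> commutes with \<open>g(y)\<close>, and
  \<open>(f(y) + g(y)) (f(y) - g(y)) = 0\<close>. If \<open>f(y) \<noteq> g(y)\<close>, the kernel of \<open>f(y) + g(y)\<close> therefore contains an
  eigenvector of \<open>y\<close>, with an eigenvalue \<open>m\<close> say, and \<open>f(m) = -g(m)\<close>. A polynomial that annihilates \<open>x\<close>,
  multiplied by a large constant, defines a free neighbourhood of \<open>x\<close> on which each eigenvalue \<open>m\<close>
  is close to an eigenvalue \<open>e\<close> of \<open>x\<close>, where \<open>f(e) = g(e)\<close>. Evaluating both branches at the triangular
  matrix with diagonal \<open>e\<close>, \<open>m\<close> and corner \<open>c\<close> gives corner entries with product \<open>c\<^sup>2 / (e - m)\<close>,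
  which contradicts local boundedness.
\<close>

text \<open>Local agreement is exactly the condition for the graphs of branches to form the base of
  a topology. Once this is known, every chart is the first projection, every transition map is an
  identity, and the manifold axioms follow from the openness of the projection and from basic free
  sets being nc-sets. The obstacle is that a free neighbourhood contains matrices of all sizes, so
  continuity of the branches at each fixed size yields no common neighbourhood. Spectra carry the
  information across sizes: a basic free set that contains \<open>y\<close> also contains the scalar
  point \<open>m\<close> for every eigenvalue \<open>m\<close> of \<open>y\<close>, and the values
  of the branches at \<open>m\<close> determine their values at \<open>y\<close> on the eigenvectors
  for \<open>m\<close>. On scalars a quantitative form of continuity is enough, and the triangular
  matrices supply it without a theory of holomorphic functions: a free open set around
  \<open>e \<oplus> e\<close> leaves room for a corner \<open>c\<close> of fixed size while
  \<open>m\<close> tends to \<open>e\<close>.\<close>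

section \<open>Operator norm of complex matrices\<close>

lemma vec_l2_norm_power2: "(vec_l2_norm v)\<^sup>2 = (\<Sum>i<dim_vec v. (cmod (v $ i))\<^sup>2)"
  unfolding vec_l2_norm_def L2_set_def by (simp add: sum_nonneg)

lemma vec_l2_norm_nonneg: "0 \<le> vec_l2_norm v"
  by (simp add: vec_l2_norm_def)

lemma vec_l2_norm_smult: "vec_l2_norm (c \<cdot>\<^sub>v v) = cmod c * vec_l2_norm v"
proof -
  have "vec_l2_norm (c \<cdot>\<^sub>v v) = L2_set (\<lambda>i. cmod c * cmod (v $ i)) {..<dim_vec v}"
    unfolding vec_l2_norm_def by (rule L2_set_cong) (auto simp: norm_mult)
  then show ?thesis
    by (simp add: L2_set_right_distrib vec_l2_norm_def)
qed

lemma vec_l2_norm_add_le: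
  assumes "u \<in> carrier_vec n" "v \<in> carrier_vec n"
  shows "vec_l2_norm (u + v) \<le> vec_l2_norm u + vec_l2_norm v"
proof -
  have "vec_l2_norm (u + v) \<le> L2_set (\<lambda>i. cmod (u $ i) + cmod (v $ i)) {..<n}"
    using assms unfolding vec_l2_norm_def by (auto intro!: L2_set_mono norm_triangle_ineq)
  also have "\<dots> \<le> vec_l2_norm u + vec_l2_norm v"
    using assms unfolding vec_l2_norm_def by (simp add: L2_set_triangle_ineq)
  finally show ?thesis .
qed

lemma cmod_index_le_vec_l2_norm:
  assumes "i < dim_vec v"
  shows "cmod (v $ i) \<le> vec_l2_norm v"
  unfolding vec_l2_norm_def using assms
  by (intro member_le_L2_set[of "{..<dim_vec v}" i "\<lambda>i. cmod (v $ i)"]) auto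

lemma vec_l2_norm_mult_mat_vec_le_sum:
  assumes "A \<in> carrier_mat nr nc" "v \<in> carrier_vec nc"
  shows "vec_l2_norm (A *\<^sub>v v) \<le> (\<Sum>i<nr. \<Sum>j<nc. cmod (A $$ (i, j))) * vec_l2_norm v"
proof -
  have "cmod ((A *\<^sub>v v) $ i) \<le> (\<Sum>j<nc. cmod (A $$ (i, j))) * vec_l2_norm v" if "i < nr" for i
  proof -
    have "(A *\<^sub>v v) $ i = (\<Sum>j<nc. A $$ (i, j) * v $ j)"
      using that assms by (simp add: scalar_prod_def atLeast0LessThan)
    also have "cmod \<dots> \<le> (\<Sum>j<nc. cmod (A $$ (i, j)) * vec_l2_norm v)"
      using assms cmod_index_le_vec_l2_norm[of _ v]
      by (intro sum_norm_le) (auto simp: norm_mult intro!: mult_left_mono)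
    finally show ?thesis by (simp add: sum_distrib_right)
  qed
  then have "(\<Sum>i<nr. cmod ((A *\<^sub>v v) $ i))
      \<le> (\<Sum>i<nr. (\<Sum>j<nc. cmod (A $$ (i, j))) * vec_l2_norm v)"
    by (intro sum_mono) auto
  moreover have "vec_l2_norm (A *\<^sub>v v) \<le> (\<Sum>i<nr. cmod ((A *\<^sub>v v) $ i))"
    using assms L2_set_le_sum[of "{..<nr}" "\<lambda>i. cmod ((A *\<^sub>v v) $ i)"]
    by (simp add: vec_l2_norm_def)
  ultimately show ?thesis by (simp add: sum_distrib_right)
qed

text \<open>\<open>mat_op_norm\<close> is a supremum of reals and carries information only for a
  bounded family. The sum of the moduli of the entries is a crude bound, but it suffices.\<close>

lemma mat_op_norm_bdd_above:
  "bdd_above ((\<lambda>v. vec_l2_norm (A *\<^sub>v v)) ` {v \<in> carrier_vec (dim_col A). vec_l2_norm v \<le> 1})"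
proof (rule bdd_aboveI2)
  fix v assume v: "v \<in> {v \<in> carrier_vec (dim_col A). vec_l2_norm v \<le> 1}"
  let ?s = "\<Sum>i<dim_row A. \<Sum>j<dim_col A. cmod (A $$ (i, j))"
  have "vec_l2_norm (A *\<^sub>v v) \<le> ?s * vec_l2_norm v"
    using v by (intro vec_l2_norm_mult_mat_vec_le_sum) auto
  also have "\<dots> \<le> ?s"
    using v by (intro mult_left_le) (auto intro!: sum_nonneg)
  finally show "vec_l2_norm (A *\<^sub>v v) \<le> ?s" .
qed

lemma vec_l2_norm_mult_mat_vec_le:
  assumes v: "v \<in> carrier_vec (dim_col A)"
  shows "vec_l2_norm (A *\<^sub>v v) \<le> mat_op_norm A * vec_l2_norm v"
proof (cases "vec_l2_norm v = 0")
  case True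
  then show ?thesis
    using vec_l2_norm_mult_mat_vec_le_sum[of A "dim_row A" "dim_col A" v] v by auto
next
  case False
  define c where "c = complex_of_real (1 / vec_l2_norm v)"
  have pos: "vec_l2_norm v > 0" using False vec_l2_norm_nonneg[of v] by simp
  then have c: "cmod c = 1 / vec_l2_norm v" by (simp add: c_def norm_divide)
  have "vec_l2_norm (A *\<^sub>v (c \<cdot>\<^sub>v v)) \<le> mat_op_norm A"
    unfolding mat_op_norm_def
    by (rule cSUP_upper[OF _ mat_op_norm_bdd_above]) (use v pos c in \<open>auto simp: vec_l2_norm_smult\<close>)
  moreover have "A *\<^sub>v (c \<cdot>\<^sub>v v) = c \<cdot>\<^sub>v (A *\<^sub>v v)"
    using v by (intro mult_mat_vec[of A "dim_row A"]) auto
  ultimately have "vec_l2_norm (A *\<^sub>v v) / vec_l2_norm v \<le> mat_op_norm A"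
    using c by (simp add: vec_l2_norm_smult)
  then show ?thesis using pos by (simp add: field_simps)
qed

lemma mat_op_norm_le:
  assumes "0 \<le> c" "\<And>v. v \<in> carrier_vec (dim_col A) \<Longrightarrow> vec_l2_norm (A *\<^sub>v v) \<le> c * vec_l2_norm v"
  shows "mat_op_norm A \<le> c"
  unfolding mat_op_norm_def
proof (rule cSUP_least)
  have "0\<^sub>v (dim_col A) \<in> {v \<in> carrier_vec (dim_col A). vec_l2_norm v \<le> 1}"
    by (auto simp: vec_l2_norm_def L2_set_def)
  then show "{v \<in> carrier_vec (dim_col A). vec_l2_norm v \<le> 1} \<noteq> {}" by blast
  fix v assume v: "v \<in> {v \<in> carrier_vec (dim_col A). vec_l2_norm v \<le> 1}"
  then have "vec_l2_norm (A *\<^sub>v v) \<le> c * vec_l2_norm v" using assms by auto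
  also have "\<dots> \<le> c" using v assms by (intro mult_left_le) auto
  finally show "vec_l2_norm (A *\<^sub>v v) \<le> c" .
qed

lemma mat_op_norm_nonneg: "0 \<le> mat_op_norm A"
proof -
  have "vec_l2_norm (A *\<^sub>v 0\<^sub>v (dim_col A)) \<le> mat_op_norm A"
    unfolding mat_op_norm_def
    by (rule cSUP_upper[OF _ mat_op_norm_bdd_above]) (auto simp: vec_l2_norm_def L2_set_def)
  then show ?thesis using vec_l2_norm_nonneg order_trans by blast
qed

lemma cmod_index_le_mat_op_norm:
  assumes "i < dim_row A" "j < dim_col A"
  shows "cmod (A $$ (i, j)) \<le> mat_op_norm A"
proof -
  have "vec_l2_norm (unit_vec (dim_col A) j :: complex vec) = 1"
  proof -
    have "(vec_l2_norm (unit_vec (dim_col A) j :: complex vec))\<^sup>2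
        = (\<Sum>i<dim_col A. if i = j then 1 else 0)"
      unfolding vec_l2_norm_power2 by (rule sum.cong) (use assms in \<open>auto simp: unit_vec_def\<close>)
    also have "\<dots> = 1" using assms by simp
    finally show ?thesis using vec_l2_norm_nonneg by (simp add: power2_eq_1_iff) (smt (verit))
  qed
  moreover have "cmod ((A *\<^sub>v unit_vec (dim_col A) j) $ i) \<le> vec_l2_norm (A *\<^sub>v unit_vec (dim_col A) j)"
    using assms by (intro cmod_index_le_vec_l2_norm) auto
  moreover have "(A *\<^sub>v unit_vec (dim_col A) j) $ i = A $$ (i, j)"
    using assms by simp
  ultimately show ?thesis
    using vec_l2_norm_mult_mat_vec_le[of "unit_vec (dim_col A) j" A] by simp
qed

text \<open>Write \<open>A\<close> as \<open>B + (A - B)\<close> and use the crude entrywise bound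
  for the difference. This turns entrywise convergence into an upper estimate of the norm, which is
  all that the open condition \<open>< 1\<close> asks for.\<close>

lemma mat_op_norm_le_perturb:
  assumes "A \<in> carrier_mat nr nc" "B \<in> carrier_mat nr nc"
  shows "mat_op_norm A \<le> mat_op_norm B + (\<Sum>i<nr. \<Sum>j<nc. cmod (A $$ (i, j) - B $$ (i, j)))"
proof (rule mat_op_norm_le)
  show "0 \<le> mat_op_norm B + (\<Sum>i<nr. \<Sum>j<nc. cmod (A $$ (i, j) - B $$ (i, j)))"
    by (intro add_nonneg_nonneg mat_op_norm_nonneg sum_nonneg) auto
  fix v :: "complex vec" assume v: "v \<in> carrier_vec (dim_col A)"
  have "A = B + (A - B)" using assms by (intro eq_matI) auto
  then have "A *\<^sub>v v = B *\<^sub>v v + (A - B) *\<^sub>v v"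
    using assms v by (metis add_mult_distrib_mat_vec carrier_matD(2) minus_carrier_mat)
  then have "vec_l2_norm (A *\<^sub>v v) \<le> vec_l2_norm (B *\<^sub>v v) + vec_l2_norm ((A - B) *\<^sub>v v)"
    using vec_l2_norm_add_le[of "B *\<^sub>v v" nr "(A - B) *\<^sub>v v"]
    by (metis assms v carrier_matD(2) minus_carrier_mat mult_mat_vec_carrier)
  also have "vec_l2_norm (B *\<^sub>v v) \<le> mat_op_norm B * vec_l2_norm v"
    using assms v by (intro vec_l2_norm_mult_mat_vec_le) auto
  also have "vec_l2_norm ((A - B) *\<^sub>v v)
      \<le> (\<Sum>i<nr. \<Sum>j<nc. cmod ((A - B) $$ (i, j))) * vec_l2_norm v"
    using assms v by (intro vec_l2_norm_mult_mat_vec_le_sum) auto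
  also have "(\<Sum>i<nr. \<Sum>j<nc. cmod ((A - B) $$ (i, j))) = (\<Sum>i<nr. \<Sum>j<nc. cmod (A $$ (i, j) - B $$ (i, j)))"
    using assms by (intro sum.cong) auto
  finally show "vec_l2_norm (A *\<^sub>v v)
      \<le> (mat_op_norm B + (\<Sum>i<nr. \<Sum>j<nc. cmod (A $$ (i, j) - B $$ (i, j)))) * vec_l2_norm v"
    by (simp add: algebra_simps)
qed

text \<open>Squares of Euclidean norms add up over orthogonal blocks, norms do not; hence the
  passage to a quadratic inequality. The strictness survives as a constant \<open>c < 1\<close>
  uniform in \<open>v\<close>, with the square of the norm as witness.\<close>

lemma mat_op_norm_less_1_iff:
  "mat_op_norm A < 1 \<longleftrightarrow>
   (\<exists>c. 0 \<le> c \<and> c < 1 \<and> (\<forall>v\<in>carrier_vec (dim_col A). (vec_l2_norm (A *\<^sub>v v))\<^sup>2 \<le> c * (vec_l2_norm v)\<^sup>2))"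
proof
  assume less: "mat_op_norm A < 1"
  have "(vec_l2_norm (A *\<^sub>v v))\<^sup>2 \<le> (mat_op_norm A)\<^sup>2 * (vec_l2_norm v)\<^sup>2"
    if "v \<in> carrier_vec (dim_col A)" for v
    using power_mono[OF vec_l2_norm_mult_mat_vec_le[OF that], of 2]
    by (simp add: vec_l2_norm_nonneg power_mult_distrib)
  moreover have "(mat_op_norm A)\<^sup>2 < 1"
    using less mat_op_norm_nonneg[of A] by (simp add: power_less_one_iff)
  ultimately show "\<exists>c. 0 \<le> c \<and> c < 1 \<and>
      (\<forall>v\<in>carrier_vec (dim_col A). (vec_l2_norm (A *\<^sub>v v))\<^sup>2 \<le> c * (vec_l2_norm v)\<^sup>2)"
    by (intro exI[of _ "(mat_op_norm A)\<^sup>2"]) auto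
next
  assume "\<exists>c. 0 \<le> c \<and> c < 1 \<and>
      (\<forall>v\<in>carrier_vec (dim_col A). (vec_l2_norm (A *\<^sub>v v))\<^sup>2 \<le> c * (vec_l2_norm v)\<^sup>2)"
  then obtain c where c: "0 \<le> c" "c < 1"
    "\<And>v. v \<in> carrier_vec (dim_col A) \<Longrightarrow> (vec_l2_norm (A *\<^sub>v v))\<^sup>2 \<le> c * (vec_l2_norm v)\<^sup>2"
    by blast
  have "mat_op_norm A \<le> sqrt c"
  proof (rule mat_op_norm_le)
    fix v :: "complex vec" assume v: "v \<in> carrier_vec (dim_col A)"
    show "vec_l2_norm (A *\<^sub>v v) \<le> sqrt c * vec_l2_norm v"
      using real_sqrt_le_mono[OF c(3)[OF v]] by (simp add: real_sqrt_mult vec_l2_norm_nonneg)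
  qed (use c in simp)
  moreover have "sqrt c < 1" using c by simp
  ultimately show "mat_op_norm A < 1" by linarith
qed

section \<open>Membership in basic free sets in block coordinates\<close>

lemma sum_div_mod:
  fixes f :: "nat \<Rightarrow> nat \<Rightarrow> 'a::comm_monoid_add"
  assumes "0 < n"
  shows "(\<Sum>r<m * n. f (r div n) (r mod n)) = (\<Sum>i<m. \<Sum>k<n. f i k)"
proof -
  have "(\<Sum>r<m * n. f (r div n) (r mod n)) = (\<Sum>i<m. \<Sum>r\<in>{i*n..<i*n+n}. f (r div n) (r mod n))"
    by (simp add: sum.nat_group)
  also have "\<dots> = (\<Sum>i<m. \<Sum>k<n. f i k)"
  proof (rule sum.cong[OF refl])
    fix i :: nat
    show "(\<Sum>r\<in>{i*n..<i*n+n}. f (r div n) (r mod n)) = (\<Sum>k<n. f i k)"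
      using sum.shift_bounds_nat_ivl[of "\<lambda>r. f (r div n) (r mod n)" 0 "i*n" n] assms
      by (simp add: atLeast0LessThan add.commute)
  qed
  finally show ?thesis .
qed

text \<open>The square of the Euclidean norm of \<open>[\<delta>\<^sub>i\<^sub>j(x)] v\<close>, with a vector indexed by block and position.\<close>

definition block_sq :: "free_poly mat \<Rightarrow> nc_point \<Rightarrow> (nat \<Rightarrow> nat \<Rightarrow> complex) \<Rightarrow> real" where
  "block_sq \<delta> x v = (\<Sum>i<dim_row \<delta>. \<Sum>k<nc_size x.
     (cmod (\<Sum>j<dim_col \<delta>. \<Sum>l<nc_size x. free_poly_eval x (\<delta> $$ (i, j)) $$ (k, l) * v j l))\<^sup>2)"

lemma nc_size_pos:
  assumes "x \<in> nc_universe d" "0 < d"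
  shows "0 < nc_size x"
proof -
  obtain n where n: "1 \<le> n" "length x = d" "set x \<subseteq> carrier_mat n n"
    using assms by (auto simp: nc_universe_def nc_level_def)
  then have "hd x \<in> carrier_mat n n" using assms by (metis hd_in_set length_greater_0_conv subsetD)
  then show ?thesis using n by (auto simp: nc_size_def)
qed

text \<open>Trades the flat indices, decoded by \<open>div\<close> and \<open>mod\<close>, for pairs
  of a block and a position. The test vectors become arbitrary functions of which only the values
  inside the index ranges matter, so that they can be cut, padded with zeros and shifted
  freely.\<close>

lemma mem_basic_free_set_iff:
  assumes x: "x \<in> nc_universe d" and d: "0 < d"
  shows "x \<in> basic_free_set d \<delta> \<longleftrightarrow>
    (\<exists>c. 0 \<le> c \<and> c < 1 \<and>
      (\<forall>v. block_sq \<delta> x v \<le> c * (\<Sum>j<dim_col \<delta>. \<Sum>l<nc_size x. (cmod (v j l))\<^sup>2)))"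
proof -
  define n where "n = nc_size x"
  have n: "0 < n" using nc_size_pos[OF x d] by (simp add: n_def)
  let ?A = "free_poly_mat_eval \<delta> x"
  have dim: "dim_row ?A = dim_row \<delta> * n" "dim_col ?A = dim_col \<delta> * n"
    by (auto simp: free_poly_mat_eval_def Let_def n_def)
  have lin: "(?A *\<^sub>v w) $ r = (\<Sum>j<dim_col \<delta>. \<Sum>l<n. free_poly_eval x (\<delta> $$ (r div n, j)) $$ (r mod n, l) * v j l)"
    if r: "r < dim_row \<delta> * n" and w: "w \<in> carrier_vec (dim_col \<delta> * n)"
      and wv: "\<And>c. c < dim_col \<delta> * n \<Longrightarrow> w $ c = v (c div n) (c mod n)" for w r and v :: "nat \<Rightarrow> nat \<Rightarrow> complex"
  proof -
    have "(?A *\<^sub>v w) $ r = (\<Sum>c<dim_col \<delta> * n. ?A $$ (r, c) * w $ c)"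
      using r w dim by (simp add: scalar_prod_def atLeast0LessThan)
    also have "\<dots> = (\<Sum>c<dim_col \<delta> * n. free_poly_eval x (\<delta> $$ (r div n, c div n)) $$ (r mod n, c mod n) * v (c div n) (c mod n))"
      by (rule sum.cong[OF refl]) (use r wv in \<open>auto simp: free_poly_mat_eval_def Let_def n_def\<close>)
    also have "\<dots> = (\<Sum>j<dim_col \<delta>. \<Sum>l<n. free_poly_eval x (\<delta> $$ (r div n, j)) $$ (r mod n, l) * v j l)"
      using sum_div_mod[OF n, of "\<lambda>j l. free_poly_eval x (\<delta> $$ (r div n, j)) $$ (r mod n, l) * v j l"] by simp
    finally show ?thesis .
  qed
  have sq: "(vec_l2_norm (?A *\<^sub>v w))\<^sup>2 = block_sq \<delta> x v \<and>
     (vec_l2_norm w)\<^sup>2 = (\<Sum>j<dim_col \<delta>. \<Sum>l<n. (cmod (v j l))\<^sup>2)"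
    if w: "w \<in> carrier_vec (dim_col \<delta> * n)"
      and wv: "\<And>c. c < dim_col \<delta> * n \<Longrightarrow> w $ c = v (c div n) (c mod n)" for w and v :: "nat \<Rightarrow> nat \<Rightarrow> complex"
  proof
    have "(vec_l2_norm (?A *\<^sub>v w))\<^sup>2 = (\<Sum>r<dim_row \<delta> * n. (cmod ((?A *\<^sub>v w) $ r))\<^sup>2)"
      unfolding vec_l2_norm_power2 using dim by simp
    also have "\<dots> = (\<Sum>r<dim_row \<delta> * n. (cmod (\<Sum>j<dim_col \<delta>. \<Sum>l<n. free_poly_eval x (\<delta> $$ (r div n, j)) $$ (r mod n, l) * v j l))\<^sup>2)"
      using lin[OF _ w wv] by (intro sum.cong refl) (simp only: lessThan_iff)
    also have "\<dots> = block_sq \<delta> x v"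
      using sum_div_mod[OF n, of "\<lambda>i k. (cmod (\<Sum>j<dim_col \<delta>. \<Sum>l<n. free_poly_eval x (\<delta> $$ (i, j)) $$ (k, l) * v j l))\<^sup>2"]
      by (simp add: block_sq_def n_def)
    finally show "(vec_l2_norm (?A *\<^sub>v w))\<^sup>2 = block_sq \<delta> x v" .
    have "(vec_l2_norm w)\<^sup>2 = (\<Sum>r<dim_col \<delta> * n. (cmod (v (r div n) (r mod n)))\<^sup>2)"
      unfolding vec_l2_norm_power2 using w wv by (intro sum.cong) auto
    then show "(vec_l2_norm w)\<^sup>2 = (\<Sum>j<dim_col \<delta>. \<Sum>l<n. (cmod (v j l))\<^sup>2)"
      using sum_div_mod[OF n, of "\<lambda>j l. (cmod (v j l))\<^sup>2"] by simp
  qed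
  have "(\<forall>w\<in>carrier_vec (dim_col ?A). (vec_l2_norm (?A *\<^sub>v w))\<^sup>2 \<le> c * (vec_l2_norm w)\<^sup>2)
    \<longleftrightarrow> (\<forall>v. block_sq \<delta> x v \<le> c * (\<Sum>j<dim_col \<delta>. \<Sum>l<n. (cmod (v j l))\<^sup>2))" for c
  proof (intro iffI allI ballI)
    fix v :: "nat \<Rightarrow> nat \<Rightarrow> complex"
    assume *: "\<forall>w\<in>carrier_vec (dim_col ?A). (vec_l2_norm (?A *\<^sub>v w))\<^sup>2 \<le> c * (vec_l2_norm w)\<^sup>2"
    let ?w = "vec (dim_col \<delta> * n) (\<lambda>c. v (c div n) (c mod n))"
    show "block_sq \<delta> x v \<le> c * (\<Sum>j<dim_col \<delta>. \<Sum>l<n. (cmod (v j l))\<^sup>2)"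
      using *[rule_format, of ?w] sq[of ?w v] dim by simp
  next
    fix w :: "complex vec"
    assume *: "\<forall>v. block_sq \<delta> x v \<le> c * (\<Sum>j<dim_col \<delta>. \<Sum>l<n. (cmod (v j l))\<^sup>2)"
      and w: "w \<in> carrier_vec (dim_col ?A)"
    show "(vec_l2_norm (?A *\<^sub>v w))\<^sup>2 \<le> c * (vec_l2_norm w)\<^sup>2"
      using *[rule_format, of "\<lambda>j l. w $ (j * n + l)"] sq[of w "\<lambda>j l. w $ (j * n + l)"] w dim
      by (simp add: div_mult_mod_eq)
  qed
  then show ?thesis
    using x by (simp add: basic_free_set_def mat_op_norm_less_1_iff n_def)
qed

section \<open>Direct sums of points of basic free sets\<close>

lemma nc_size_eq:
  assumes "x \<in> nc_level d n" "0 < d"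
  shows "nc_size x = n"
proof -
  have "hd x \<in> carrier_mat n n"
    using assms by (auto simp: nc_level_def subset_iff)
  then show ?thesis by (auto simp: nc_size_def)
qed

lemma nc_universe_iff:
  assumes "0 < d"
  shows "x \<in> nc_universe d \<longleftrightarrow> 0 < nc_size x \<and> x \<in> nc_level d (nc_size x)"
proof
  assume "x \<in> nc_universe d"
  then obtain n where "1 \<le> n" "x \<in> nc_level d n" by (auto simp: nc_universe_def)
  then show "0 < nc_size x \<and> x \<in> nc_level d (nc_size x)" using nc_size_eq[OF _ assms] by simp
next
  assume "0 < nc_size x \<and> x \<in> nc_level d (nc_size x)"
  then show "x \<in> nc_universe d" unfolding nc_universe_def by (intro UN_I[of "nc_size x"]) simp_all
qed

lemma nth_nc_level:
  assumes "x \<in> nc_level d n" "i < d"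
  shows "x ! i \<in> carrier_mat n n"
  using assms by (auto simp: nc_level_def subset_iff)

lemma word_eval_carrier:
  assumes "x \<in> nc_level d n" "0 < d" "set w \<subseteq> {..<d}"
  shows "word_eval x w \<in> carrier_mat n n"
  using assms(3)
proof (induction w)
  case Nil
  then show ?case using nc_size_eq[OF assms(1,2)] by (simp add: word_eval_def)
next
  case (Cons i w)
  then show ?case using nth_nc_level[OF assms(1), of i] by (auto simp: word_eval_def)
qed

lemma mat_dsum_carrier:
  assumes "A \<in> carrier_mat n n" "B \<in> carrier_mat m m"
  shows "mat_dsum A B \<in> carrier_mat (n + m) (n + m)"
  using assms by (auto simp: mat_dsum_def)

lemma mat_dsum_one: "mat_dsum (1\<^sub>m n) (1\<^sub>m m) = 1\<^sub>m (n + m)"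
  by (rule eq_matI) (auto simp: mat_dsum_def)

lemma mat_dsum_mult:
  assumes "A \<in> carrier_mat n n" "B \<in> carrier_mat m m" "C \<in> carrier_mat n n" "D \<in> carrier_mat m m"
  shows "mat_dsum A B * mat_dsum C D = mat_dsum (A * C) (B * D)"
  using assms
  by (simp add: mat_dsum_def mult_four_block_mat[of A n n _ m _ m _ C n _ m]
      right_add_zero_mat[of _ n n] left_add_zero_mat[of _ m m])

lemma nc_dsum_nc_level:
  assumes "x \<in> nc_level d n" "y \<in> nc_level d m"
  shows "nc_dsum x y \<in> nc_level d (n + m)"
  unfolding nc_level_def
proof (intro CollectI conjI subsetI)
  show len: "length (nc_dsum x y) = d" using assms by (auto simp: nc_level_def nc_dsum_def)
  fix A assume "A \<in> set (nc_dsum x y)"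
  then obtain i where i: "i < d" "A = nc_dsum x y ! i" using len by (auto simp: in_set_conv_nth)
  then have "A = mat_dsum (x ! i) (y ! i)" using assms by (auto simp: nc_level_def nc_dsum_def)
  then show "A \<in> carrier_mat (n + m) (n + m)"
    using mat_dsum_carrier nth_nc_level[OF assms(1) i(1)] nth_nc_level[OF assms(2) i(1)] by simp
qed

lemma word_eval_nc_dsum:
  assumes x: "x \<in> nc_level d n" and y: "y \<in> nc_level d m" and d: "0 < d" and w: "set w \<subseteq> {..<d}"
  shows "word_eval (nc_dsum x y) w = mat_dsum (word_eval x w) (word_eval y w)"
  using w
proof (induction w)
  case Nil
  then show ?case
    using nc_size_eq[OF x d] nc_size_eq[OF y d] nc_size_eq[OF nc_dsum_nc_level[OF x y] d]
    by (simp add: word_eval_def mat_dsum_one)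
next
  case (Cons i w)
  then have i: "i < d" and w: "set w \<subseteq> {..<d}" by auto
  have "nc_dsum x y ! i = mat_dsum (x ! i) (y ! i)"
    using x y i by (auto simp: nc_level_def nc_dsum_def)
  then show ?case
    using Cons.IH[OF w] mat_dsum_mult[OF nth_nc_level[OF x i] nth_nc_level[OF y i]
        word_eval_carrier[OF x d w] word_eval_carrier[OF y d w]]
    by (simp add: word_eval_def)
qed

lemma free_poly_eval_nc_dsum:
  assumes x: "x \<in> nc_level d n" and y: "y \<in> nc_level d m" and d: "0 < d" and p: "free_poly_vars d p"
  shows "free_poly_eval (nc_dsum x y) p = mat_dsum (free_poly_eval x p) (free_poly_eval y p)"
proof (rule eq_matI)
  have dims: "nc_size x = n" "nc_size y = m" "nc_size (nc_dsum x y) = n + m"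
    using nc_size_eq[OF x d] nc_size_eq[OF y d] nc_size_eq[OF nc_dsum_nc_level[OF x y] d] by auto
  show "dim_row (free_poly_eval (nc_dsum x y) p) = dim_row (mat_dsum (free_poly_eval x p) (free_poly_eval y p))"
    "dim_col (free_poly_eval (nc_dsum x y) p) = dim_col (mat_dsum (free_poly_eval x p) (free_poly_eval y p))"
    by (auto simp: free_poly_eval_def mat_dsum_def dims)
  fix i j assume "i < dim_row (mat_dsum (free_poly_eval x p) (free_poly_eval y p))"
    "j < dim_col (mat_dsum (free_poly_eval x p) (free_poly_eval y p))"
  then have ij: "i < n + m" "j < n + m"
    by (auto simp: free_poly_eval_def mat_dsum_def dims)
  have "free_poly_eval (nc_dsum x y) p $$ (i, j)
     = (\<Sum>w\<in>Poly_Mapping.keys p. Poly_Mapping.lookup p w *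
          (if i < n then if j < n then word_eval x w $$ (i, j) else 0
           else if j < n then 0 else word_eval y w $$ (i - n, j - n)))"
    unfolding free_poly_eval_def dims using ij
  proof (simp, intro sum.cong refl)
    fix w assume "w \<in> Poly_Mapping.keys p"
    then have w: "set w \<subseteq> {..<d}" using p by (auto simp: free_poly_vars_def)
    show "Poly_Mapping.lookup p w * word_eval (nc_dsum x y) w $$ (i, j) = Poly_Mapping.lookup p w *
          (if i < n then if j < n then word_eval x w $$ (i, j) else 0
           else if j < n then 0 else word_eval y w $$ (i - n, j - n))"
      using ij word_eval_carrier[OF x d w] word_eval_carrier[OF y d w]
      by (auto simp: word_eval_nc_dsum[OF x y d w] mat_dsum_def)
  qed
  then show "free_poly_eval (nc_dsum x y) p $$ (i, j)
      = mat_dsum (free_poly_eval x p) (free_poly_eval y p) $$ (i, j)"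
    using ij by (auto simp: mat_dsum_def free_poly_eval_def dims)
qed

lemma sum_lessThan_add:
  fixes f :: "nat \<Rightarrow> 'a::comm_monoid_add"
  shows "(\<Sum>k<n + m. f k) = (\<Sum>k<n. f k) + (\<Sum>k<m. f (n + k))"
  by (induction m) (auto simp: add.assoc)

text \<open>Pythagoras: at a direct sum every polynomial acts diagonally, so within each block the
  first \<open>n\<close> positions see only \<open>x\<close>, and the later ones, read with the
  offset \<open>n\<close>, see only \<open>y\<close>.\<close>

lemma block_sq_nc_dsum:
  assumes x: "x \<in> nc_level d n" and y: "y \<in> nc_level d m" and d: "0 < d" and \<delta>: "free_poly_mat d \<delta>"
  shows "block_sq \<delta> (nc_dsum x y) v = block_sq \<delta> x v + block_sq \<delta> y (\<lambda>j l. v j (n + l))"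
proof -
  have dims: "nc_size x = n" "nc_size y = m" "nc_size (nc_dsum x y) = n + m"
    using nc_size_eq[OF x d] nc_size_eq[OF y d] nc_size_eq[OF nc_dsum_nc_level[OF x y] d] by auto
  define E where "E i j = mat_dsum (free_poly_eval x (\<delta> $$ (i, j))) (free_poly_eval y (\<delta> $$ (i, j)))" for i j
  have E: "free_poly_eval (nc_dsum x y) (\<delta> $$ (i, j)) = E i j"
    if "i < dim_row \<delta>" "j < dim_col \<delta>" for i j
    unfolding E_def using \<delta> that
    by (intro free_poly_eval_nc_dsum[OF x y d]) (simp add: free_poly_mat_def elements_matI[of \<delta> "dim_row \<delta>" "dim_col \<delta>" i j])
  have "dim_row (free_poly_eval x p) = n" "dim_col (free_poly_eval x p) = n"
    "dim_row (free_poly_eval y p) = m" "dim_col (free_poly_eval y p) = m" for p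
    by (simp_all add: free_poly_eval_def dims)
  note D = this E_def mat_dsum_def
  have E1: "E i j $$ (k, l) = free_poly_eval x (\<delta> $$ (i, j)) $$ (k, l)"
    if "k < n" "l < n" for i j k l
    using that by (simp add: D)
  have E2: "E i j $$ (n + k, n + l) = free_poly_eval y (\<delta> $$ (i, j)) $$ (k, l)"
    if "k < m" "l < m" for i j k l
    using that by (simp add: D)
  have E2': "E i j $$ (n + k, l) = 0" if "k < m" "l < n" for i j k l
    using that by (simp add: D)
  have E3: "E i j $$ (k, n + l) = 0" if "k < n" "l < m" for i j k l
    using that by (simp add: D)
  have "block_sq \<delta> (nc_dsum x y) v = (\<Sum>i<dim_row \<delta>. \<Sum>k<n+m.
     (cmod (\<Sum>j<dim_col \<delta>. \<Sum>l<n+m. E i j $$ (k, l) * v j l))\<^sup>2)"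
    unfolding block_sq_def dims by (simp add: E)
  also have "\<dots> = block_sq \<delta> x v + block_sq \<delta> y (\<lambda>j l. v j (n + l))"
    unfolding block_sq_def dims by (simp add: sum_lessThan_add E1 E2 E2' E3 sum.distrib)
  finally show ?thesis .
qed

text \<open>The norm of an orthogonal sum is the maximum of the two norms; accordingly the larger of
  the two constants serves for the direct sum and is still below 1.\<close>

lemma nc_set_basic_free_set:
  assumes d: "0 < d" and \<delta>: "free_poly_mat d \<delta>"
  shows "nc_set d (basic_free_set d \<delta>)"
  unfolding nc_set_def
proof (intro conjI ballI)
  show "basic_free_set d \<delta> \<subseteq> nc_universe d" by (auto simp: basic_free_set_def)
  fix x y assume xy: "x \<in> basic_free_set d \<delta>" "y \<in> basic_free_set d \<delta>"
  then have uni: "x \<in> nc_universe d" "y \<in> nc_universe d" by (auto simp: basic_free_set_def)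
  define n m where "n = nc_size x" and "m = nc_size y"
  have x: "x \<in> nc_level d n" "0 < n" and y: "y \<in> nc_level d m" "0 < m"
    using uni d by (auto simp: nc_universe_iff n_def m_def)
  have z: "nc_dsum x y \<in> nc_level d (n + m)" by (rule nc_dsum_nc_level[OF x(1) y(1)])
  have nm: "nc_size (nc_dsum x y) = n + m" by (rule nc_size_eq[OF z d])
  have zu: "nc_dsum x y \<in> nc_universe d" using z x d by (simp add: nc_universe_iff nm)
  obtain a where a: "0 \<le> a" "a < 1"
    "\<And>v. block_sq \<delta> x v \<le> a * (\<Sum>j<dim_col \<delta>. \<Sum>l<n. (cmod (v j l))\<^sup>2)"
    using xy(1) mem_basic_free_set_iff[OF uni(1) d] by (auto simp: n_def)
  obtain b where b: "0 \<le> b" "b < 1"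
    "\<And>v. block_sq \<delta> y v \<le> b * (\<Sum>j<dim_col \<delta>. \<Sum>l<m. (cmod (v j l))\<^sup>2)"
    using xy(2) mem_basic_free_set_iff[OF uni(2) d] by (auto simp: m_def)
  have "block_sq \<delta> (nc_dsum x y) v \<le> max a b * (\<Sum>j<dim_col \<delta>. \<Sum>l<n + m. (cmod (v j l))\<^sup>2)" for v
  proof -
    have "block_sq \<delta> x v \<le> max a b * (\<Sum>j<dim_col \<delta>. \<Sum>l<n. (cmod (v j l))\<^sup>2)"
      by (rule order_trans[OF a(3)]) (auto intro!: mult_right_mono sum_nonneg)
    moreover have "block_sq \<delta> y (\<lambda>j l. v j (n + l))
        \<le> max a b * (\<Sum>j<dim_col \<delta>. \<Sum>l<m. (cmod (v j (n + l)))\<^sup>2)"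
      by (rule order_trans[OF b(3)]) (auto intro!: mult_right_mono sum_nonneg)
    ultimately show ?thesis
      by (simp add: block_sq_nc_dsum[OF x(1) y(1) d \<delta>] sum_lessThan_add sum.distrib distrib_left)
  qed
  moreover have "0 \<le> max a b" "max a b < 1" using a(1,2) b(1,2) by simp_all
  ultimately show "nc_dsum x y \<in> basic_free_set d \<delta>"
    unfolding mem_basic_free_set_iff[OF zu d] nm by blast
qed

section \<open>Intersections of basic free sets and the free topology\<close>

lemma free_poly_eval_zero:
  assumes "k < nc_size x" "l < nc_size x"
  shows "free_poly_eval x 0 $$ (k, l) = 0"
  using assms by (simp add: free_poly_eval_def)

lemma block_sq_nonneg: "0 \<le> block_sq \<delta> x v"
  by (simp add: block_sq_def sum_nonneg)

text \<open>The value of a block diagonal matrix of polynomials has the maximum of the two norms as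
  its norm, so this matrix describes the intersection of the two basic free sets.\<close>

definition poly_mat_dsum :: "free_poly mat \<Rightarrow> free_poly mat \<Rightarrow> free_poly mat" where
  "poly_mat_dsum \<delta> \<gamma> =
     four_block_mat \<delta> (0\<^sub>m (dim_row \<delta>) (dim_col \<gamma>)) (0\<^sub>m (dim_row \<gamma>) (dim_col \<delta>)) \<gamma>"

lemma dim_poly_mat_dsum [simp]:
  "dim_row (poly_mat_dsum \<delta> \<gamma>) = dim_row \<delta> + dim_row \<gamma>"
  "dim_col (poly_mat_dsum \<delta> \<gamma>) = dim_col \<delta> + dim_col \<gamma>"
  by (simp_all add: poly_mat_dsum_def)

lemma block_sq_poly_mat_dsum:
  "block_sq (poly_mat_dsum \<delta> \<gamma>) x v = block_sq \<delta> x v + block_sq \<gamma> x (\<lambda>j. v (dim_col \<delta> + j))"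
  unfolding block_sq_def
  by (simp add: poly_mat_dsum_def sum_lessThan_add sum.distrib free_poly_eval_zero)

lemma free_poly_mat_poly_mat_dsum:
  assumes "free_poly_mat d \<delta>" "free_poly_mat d \<gamma>"
  shows "free_poly_mat d (poly_mat_dsum \<delta> \<gamma>)"
proof -
  have zero: "p = 0" if "p \<in> elements_mat (0\<^sub>m nr nc)" for p :: free_poly and nr nc
    using subsetD[OF elements_0_mat that] by simp
  have sub: "elements_mat (poly_mat_dsum \<delta> \<gamma>) \<subseteq> elements_mat \<delta> \<union> elements_mat (0\<^sub>m (dim_row \<delta>) (dim_col \<gamma>))
      \<union> elements_mat (0\<^sub>m (dim_row \<gamma>) (dim_col \<delta>)) \<union> elements_mat \<gamma>"
    unfolding poly_mat_dsum_def
    by (rule elements_four_block_mat) (rule carrier_matI[OF refl refl] zero_carrier_mat)+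
  have "p \<in> elements_mat \<delta> \<or> p \<in> elements_mat \<gamma> \<or> p = 0" if "p \<in> elements_mat (poly_mat_dsum \<delta> \<gamma>)" for p
    using zero subsetD[OF sub that] by (elim UnE) simp_all
  moreover have "free_poly_vars d 0" by (simp add: free_poly_vars_def)
  ultimately have "free_poly_vars d p" if "p \<in> elements_mat (poly_mat_dsum \<delta> \<gamma>)" for p
    using assms that unfolding free_poly_mat_def by metis
  then show ?thesis
    using assms unfolding free_poly_mat_def dim_poly_mat_dsum by simp
qed

lemma basic_free_set_poly_mat_dsum:
  assumes d: "0 < d"
  shows "basic_free_set d (poly_mat_dsum \<delta> \<gamma>) = basic_free_set d \<delta> \<inter> basic_free_set d \<gamma>"
proof -
    have "x \<in> basic_free_set d (poly_mat_dsum \<delta> \<gamma>) \<longleftrightarrow> x \<in> basic_free_set d \<delta> \<and> x \<in> basic_free_set d \<gamma>"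
      if x: "x \<in> nc_universe d" for x
    proof
      define N where "N C v = (\<Sum>j<C. \<Sum>l<nc_size x. (cmod (v j l))\<^sup>2)"
        for C and v :: "nat \<Rightarrow> nat \<Rightarrow> complex"
      have N0: "0 \<le> N C v" for C v by (auto simp: N_def intro!: sum_nonneg)
      have Nadd: "N (dim_col (poly_mat_dsum \<delta> \<gamma>)) v = N (dim_col \<delta>) v + N (dim_col \<gamma>) (\<lambda>j. v (dim_col \<delta> + j))" for v
        by (simp add: N_def sum_lessThan_add)
      note iff = mem_basic_free_set_iff[OF x d, folded N_def]
      {
        assume "x \<in> basic_free_set d (poly_mat_dsum \<delta> \<gamma>)"
        then obtain c where c: "0 \<le> c" "c < 1" "\<And>v. block_sq (poly_mat_dsum \<delta> \<gamma>) x v \<le> c * N (dim_col (poly_mat_dsum \<delta> \<gamma>)) v"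
          unfolding iff by blast
        have "block_sq \<delta> x v \<le> c * N (dim_col \<delta>) v" for v
        proof -
          \<comment> \<open>Zeros in the columns of \<open>\<gamma>\<close> isolate
            \<open>\<delta>\<close>: the part that belongs to \<open>\<gamma>\<close> adds a
            nonnegative term on the left and nothing on the right. The mirrored choice isolates
            \<open>\<gamma>\<close>.\<close>
          let ?v = "\<lambda>j. if j < dim_col \<delta> then v j else (\<lambda>_. 0)"
          have e: "block_sq \<delta> x ?v = block_sq \<delta> x v" "N (dim_col \<delta>) ?v = N (dim_col \<delta>) v"
            "N (dim_col \<gamma>) (\<lambda>j. ?v (dim_col \<delta> + j)) = 0"
            by (simp_all add: block_sq_def N_def)
          show ?thesis
            using c(3)[of ?v] block_sq_nonneg[of \<gamma> x "\<lambda>j. ?v (dim_col \<delta> + j)"]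
            unfolding block_sq_poly_mat_dsum Nadd e by simp
        qed
        moreover have "block_sq \<gamma> x v \<le> c * N (dim_col \<gamma>) v" for v
        proof -
          let ?v = "\<lambda>j. if j < dim_col \<delta> then (\<lambda>_. 0) else v (j - dim_col \<delta>)"
          have "N (dim_col \<delta>) ?v = 0" by (simp add: N_def)
          then show ?thesis
            using c(3)[of ?v] block_sq_nonneg[of \<delta> x ?v]
            unfolding block_sq_poly_mat_dsum Nadd by simp
        qed
        ultimately show "x \<in> basic_free_set d \<delta> \<and> x \<in> basic_free_set d \<gamma>"
          unfolding iff using c(1,2) by blast
      }
      {
        assume "x \<in> basic_free_set d \<delta> \<and> x \<in> basic_free_set d \<gamma>"
        then obtain a b where ab: "0 \<le> a" "a < 1" "\<And>v. block_sq \<delta> x v \<le> a * N (dim_col \<delta>) v"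
           "0 \<le> b" "b < 1" "\<And>v. block_sq \<gamma> x v \<le> b * N (dim_col \<gamma>) v"
          unfolding iff by blast
        have "block_sq (poly_mat_dsum \<delta> \<gamma>) x v \<le> max a b * N (dim_col (poly_mat_dsum \<delta> \<gamma>)) v" for v
        proof -
          have "block_sq \<delta> x v \<le> max a b * N (dim_col \<delta>) v"
            by (rule order_trans[OF ab(3)]) (auto intro!: mult_right_mono N0)
          moreover have "block_sq \<gamma> x (\<lambda>j. v (dim_col \<delta> + j))
              \<le> max a b * N (dim_col \<gamma>) (\<lambda>j. v (dim_col \<delta> + j))"
            by (rule order_trans[OF ab(6)]) (auto intro!: mult_right_mono N0)
          ultimately show ?thesis
            unfolding block_sq_poly_mat_dsum Nadd distrib_left by linarith
        qed
        moreover have "0 \<le> max a b" "max a b < 1" using ab(1,2,4,5) by simp_all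
        ultimately show "x \<in> basic_free_set d (poly_mat_dsum \<delta> \<gamma>)"
          unfolding iff by blast
      }
    qed
    then show ?thesis by (auto simp: basic_free_set_def)
qed

text \<open>\<open>topology\<close> is meaningful only if the unions of members of the base form a
  topology, and the hypothesis is the base condition that ensures this. For the free topology it
  holds because basic free sets are closed under intersection, for the surface because of the local
  agreement of branches.\<close>

lemma openin_topology_with_base:
  assumes "\<And>S T x. S \<in> \<B> \<Longrightarrow> T \<in> \<B> \<Longrightarrow> x \<in> S \<inter> T \<Longrightarrow> \<exists>B\<in>\<B>. x \<in> B \<and> B \<subseteq> S \<inter> T"
  shows "openin (topology_with_base \<B>) W \<longleftrightarrow> (\<forall>x\<in>W. \<exists>B\<in>\<B>. x \<in> B \<and> B \<subseteq> W)"
proof -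
  have union: "(arbitrary union_of (\<lambda>B. B \<in> \<B>)) W \<longleftrightarrow> (\<forall>x\<in>W. \<exists>B\<in>\<B>. x \<in> B \<and> B \<subseteq> W)" for W
  proof
    assume "(arbitrary union_of (\<lambda>B. B \<in> \<B>)) W"
    then show "\<forall>x\<in>W. \<exists>B\<in>\<B>. x \<in> B \<and> B \<subseteq> W" by (auto simp: union_of_def)
  next
    assume "\<forall>x\<in>W. \<exists>B\<in>\<B>. x \<in> B \<and> B \<subseteq> W"
    then have "\<Union>{B\<in>\<B>. B \<subseteq> W} = W" by blast
    then show "(arbitrary union_of (\<lambda>B. B \<in> \<B>)) W"
      unfolding union_of_def arbitrary_def by (intro exI[of _ "{B\<in>\<B>. B \<subseteq> W}"]) auto
  qed
  have "istopology (arbitrary union_of (\<lambda>B. B \<in> \<B>))"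
    unfolding istopology_base_eq union using assms by blast
  then show ?thesis
    by (simp add: topology_with_base_def topology_inverse' union)
qed

lemma openin_free_topology:
  assumes d: "0 < d"
  shows "openin (free_topology d) W \<longleftrightarrow>
    (\<forall>x\<in>W. \<exists>\<delta>. free_poly_mat d \<delta> \<and> x \<in> basic_free_set d \<delta> \<and> basic_free_set d \<delta> \<subseteq> W)"
proof -
  let ?\<B> = "{basic_free_set d \<delta> |\<delta>. free_poly_mat d \<delta>}"
  have Int: "S \<inter> T \<in> ?\<B>" if ST: "S \<in> ?\<B>" "T \<in> ?\<B>" for S T
  proof -
    obtain \<delta> \<gamma> where "free_poly_mat d \<delta>" "free_poly_mat d \<gamma>"
      "S = basic_free_set d \<delta>" "T = basic_free_set d \<gamma>" using ST by auto
    then have "free_poly_mat d (poly_mat_dsum \<delta> \<gamma>)" "basic_free_set d (poly_mat_dsum \<delta> \<gamma>) = S \<inter> T"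
      using free_poly_mat_poly_mat_dsum basic_free_set_poly_mat_dsum[OF d] by auto
    then show ?thesis by (intro CollectI exI[of _ "poly_mat_dsum \<delta> \<gamma>"]) simp
  qed
  have "openin (free_topology d) W \<longleftrightarrow> (\<forall>x\<in>W. \<exists>B\<in>?\<B>. x \<in> B \<and> B \<subseteq> W)"
    unfolding free_topology_def
  proof (rule openin_topology_with_base)
    fix S T x assume "S \<in> ?\<B>" "T \<in> ?\<B>" "x \<in> S \<inter> T"
    then show "\<exists>B\<in>?\<B>. x \<in> B \<and> B \<subseteq> S \<inter> T" using Int[of S T] by (intro bexI[of _ "S \<inter> T"]) simp_all
  qed
  moreover have "(\<exists>B\<in>{b \<delta> |\<delta>. P \<delta>}. Q B) \<longleftrightarrow> (\<exists>\<delta>. P \<delta> \<and> Q (b \<delta>))"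
    for P Q and b :: "free_poly mat \<Rightarrow> nc_point set"
    by auto
  ultimately show ?thesis by (simp only:)
qed

lemma openin_basic_free_set:
  assumes "0 < d" "free_poly_mat d \<delta>"
  shows "openin (free_topology d) (basic_free_set d \<delta>)"
  using assms by (auto simp: openin_free_topology)

section \<open>Annihilating products of shifts and eigenvectors\<close>

text \<open>The product of the matrices \<open>A - a\<close> for \<open>a\<close> in
  \<open>as\<close>, applied to \<open>v\<close>, where the last entry of \<open>as\<close> acts
  first. Acting on a vector instead of forming the matrix product keeps the intermediate vectors,
  among which an eigenvector will be found.\<close>

definition shift_chain :: "complex mat \<Rightarrow> complex list \<Rightarrow> complex vec \<Rightarrow> complex vec" where
  "shift_chain A as v = foldr (\<lambda>a w. A *\<^sub>v w - a \<cdot>\<^sub>v w) as v"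

lemma shift_chain_Nil [simp]: "shift_chain A [] v = v"
  by (simp add: shift_chain_def)

lemma shift_chain_Cons [simp]:
  "shift_chain A (a # as) v = A *\<^sub>v shift_chain A as v - a \<cdot>\<^sub>v shift_chain A as v"
  by (simp add: shift_chain_def)

lemma shift_chain_snoc [simp]:
  "shift_chain A (as @ [a]) v = shift_chain A as (A *\<^sub>v v - a \<cdot>\<^sub>v v)"
  by (simp add: shift_chain_def)

lemma shift_chain_carrier:
  assumes "A \<in> carrier_mat n n" "v \<in> carrier_vec n"
  shows "shift_chain A as v \<in> carrier_vec n"
  using assms by (induction as) auto

text \<open>Subtracting the last diagonal entry concerned moves a vector supported on the first
  \<open>k + 1\<close> coordinates to one supported on the first \<open>k\<close>, so a flag of
  coordinate subspaces is descended down to 0.\<close>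

lemma shift_chain_upper_triangular:
  assumes T: "T \<in> carrier_mat n n" "upper_triangular T"
    and v: "v \<in> carrier_vec n" "\<And>i. k \<le> i \<Longrightarrow> i < n \<Longrightarrow> v $ i = 0" and k: "k \<le> n"
  shows "shift_chain T (take k (diag_mat T)) v = 0\<^sub>v n"
  using v k
proof (induction k arbitrary: v)
  case 0
  then show ?case by (intro eq_vecI) auto
next
  case (Suc k)
  let ?a = "T $$ (k, k)" and ?w = "T *\<^sub>v v - T $$ (k, k) \<cdot>\<^sub>v v"
  have take: "take (Suc k) (diag_mat T) = take k (diag_mat T) @ [?a]"
    using Suc.prems(3) T by (simp add: diag_mat_def take_Suc_conv_app_nth)
  have "?w $ i = 0" if i: "k \<le> i" "i < n" for i
  proof -
    \<comment> \<open>For \<open>j < k\<close> the matrix entry lies below the diagonal, because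
      \<open>k \<le> i\<close>; for \<open>j > k\<close> the entry of \<open>v\<close> vanishes.
      Only column \<open>k\<close> survives, and in row \<open>k\<close> the shift cancels
      it.\<close>
    have zero: "T $$ (i, j) * v $ j = 0" if "j < n" "j \<noteq> k" for j
    proof (cases "j < k")
      case True
      then show ?thesis using upper_triangularD[OF T(2), of j i] T(1) i by simp
    next
      case False
      then show ?thesis using Suc.prems(2)[of j] that by simp
    qed
    have "(T *\<^sub>v v) $ i = (\<Sum>j<n. T $$ (i, j) * v $ j)"
      using T(1) i Suc.prems(1) by (simp add: scalar_prod_def atLeast0LessThan)
    also have "\<dots> = (\<Sum>j\<in>{k}. T $$ (i, j) * v $ j)"
      by (rule sum.mono_neutral_right) (use zero Suc.prems(3) in auto)
    finally have "(T *\<^sub>v v) $ i = T $$ (i, k) * v $ k" by simp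
    moreover have "T $$ (i, k) = 0 \<and> v $ i = 0" if "i \<noteq> k"
      using upper_triangularD[OF T(2), of k i] T(1) i that Suc.prems(2)[of i] by simp
    ultimately show ?thesis using i Suc.prems(1) T(1) by (cases "i = k") simp_all
  qed
  moreover have "?w \<in> carrier_vec n" using T(1) Suc.prems(1) by simp
  ultimately show ?case
    unfolding take shift_chain_snoc using Suc.prems(3) by (intro Suc.IH) simp_all
qed

lemma shift_chain_similar:
  assumes "B \<in> carrier_mat n n" "P \<in> carrier_mat n n" "Q \<in> carrier_mat n n" "Q * P = 1\<^sub>m n"
    and v: "v \<in> carrier_vec n"
  shows "shift_chain (P * B * Q) as (P *\<^sub>v v) = P *\<^sub>v shift_chain B as v"
proof (induction as)
  case (Cons a as)
  define u where "u = shift_chain B as v"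
  have u: "u \<in> carrier_vec n" unfolding u_def by (rule shift_chain_carrier) fact+
  have "Q *\<^sub>v (P *\<^sub>v u) = u"
    using assms u by (simp add: assoc_mult_mat_vec[of Q n n P n u, symmetric])
  then have "P * B * Q *\<^sub>v (P *\<^sub>v u) = P *\<^sub>v (B *\<^sub>v u)"
    using assms u by (simp add: assoc_mult_mat_vec[of _ n n _ n])
  moreover have "P *\<^sub>v (B *\<^sub>v u - a \<cdot>\<^sub>v u) = P *\<^sub>v (B *\<^sub>v u) - a \<cdot>\<^sub>v (P *\<^sub>v u)"
    using assms u by (simp add: mult_minus_distrib_mat_vec[of _ n n] mult_mat_vec[of _ n n])
  ultimately show ?case using Cons by (simp add: u_def)
qed simp

text \<open>Cayley-Hamilton in factored form. The diagonal of the Schur form lists the roots of the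
  characteristic polynomial, so the triangular case applies, and similarity carries the result back
  to \<open>A\<close>.\<close>

lemma shift_chain_annihilates:
  fixes A :: "complex mat"
  assumes A: "A \<in> carrier_mat n n"
  obtains as where "\<And>a. a \<in> set as \<Longrightarrow> eigenvalue A a"
    "\<And>v. v \<in> carrier_vec n \<Longrightarrow> shift_chain A as v = 0\<^sub>v n"
proof -
  obtain as where as: "char_poly A = (\<Prod>a\<leftarrow>as. [:- a, 1:])"
    using char_poly_factorized[OF A] by blast
  obtain B P Q where BPQ: "schur_decomposition A as = (B, P, Q)" by (metis prod_cases3)
  have wit: "similar_mat_wit A B P Q" and B: "upper_triangular B" and diag: "diag_mat B = as"
    using schur_decomposition[OF A as BPQ] by auto
  have car: "B \<in> carrier_mat n n" "P \<in> carrier_mat n n" "Q \<in> carrier_mat n n"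
    and PQ: "P * Q = 1\<^sub>m n" "Q * P = 1\<^sub>m n" and APBQ: "A = P * B * Q"
    using wit A by (auto simp: similar_mat_wit_def Let_def)
  have "shift_chain A as v = 0\<^sub>v n" if v: "v \<in> carrier_vec n" for v
  proof -
    have "length as = n" using diag car(1) by (auto simp: diag_mat_def)
    then have "shift_chain B as (Q *\<^sub>v v) = 0\<^sub>v n"
      using shift_chain_upper_triangular[OF car(1) B, of "Q *\<^sub>v v" n] car v diag by simp
    moreover have "P *\<^sub>v (Q *\<^sub>v v) = v"
      using PQ car v by (simp add: assoc_mult_mat_vec[of P n n Q n v, symmetric])
    moreover have "P *\<^sub>v 0\<^sub>v n = 0\<^sub>v n" using car by (intro eq_vecI) auto
    ultimately show ?thesis
      using shift_chain_similar[OF car PQ(2), of "Q *\<^sub>v v" as] car v unfolding APBQ by simp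
  qed
  moreover have "eigenvalue A a" if "a \<in> set as" for a
    using that by (simp add: eigenvalue_root_char_poly[OF A] as poly_prod_list prod_list_zero_iff image_iff)
  ultimately show ?thesis using that by blast
qed

text \<open>Along an annihilating chain that starts at \<open>v\<close>, the last nonzero vector is
  an eigenvector, and every vector of the chain inherits \<open>Q\<close>. In the application
  \<open>Q\<close> is membership in the kernel of a matrix that commutes with
  \<open>A\<close>.\<close>

lemma exists_eigenvector_in_invariant:
  fixes A :: "complex mat"
  assumes A: "A \<in> carrier_mat n n" and v: "v \<in> carrier_vec n" "v \<noteq> 0\<^sub>v n" "Q v"
    and Q: "\<And>w a. w \<in> carrier_vec n \<Longrightarrow> Q w \<Longrightarrow> Q (A *\<^sub>v w - a \<cdot>\<^sub>v w)"
  obtains w a where "w \<in> carrier_vec n" "w \<noteq> 0\<^sub>v n" "A *\<^sub>v w = a \<cdot>\<^sub>v w" "Q w"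
proof -
  have inv: "Q (shift_chain A as v)" for as
    by (induction as) (auto intro!: Q v shift_chain_carrier[OF A v(1)])
  have "\<exists>w a. w \<in> carrier_vec n \<and> w \<noteq> 0\<^sub>v n \<and> A *\<^sub>v w = a \<cdot>\<^sub>v w \<and> Q w"
    if "shift_chain A as v = 0\<^sub>v n" for as
    using that
  proof (induction as)
    case Nil
    then show ?case using v by simp
  next
    case (Cons a as)
    define u where "u = shift_chain A as v"
    have u: "u \<in> carrier_vec n" unfolding u_def by (rule shift_chain_carrier[OF A v(1)])
    show ?case
    proof (cases "u = 0\<^sub>v n")
      case True
      then show ?thesis using Cons.IH u_def by simp
    next
      case False
      have eq: "A *\<^sub>v u - a \<cdot>\<^sub>v u = 0\<^sub>v n" using Cons.prems by (simp add: u_def)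
      have "A *\<^sub>v u = a \<cdot>\<^sub>v u"
      proof (rule eq_vecI)
        fix i assume "i < dim_vec (a \<cdot>\<^sub>v u)"
        then have i: "i < n" using u by simp
        then have "(A *\<^sub>v u - a \<cdot>\<^sub>v u) $ i = 0" by (simp only: eq index_zero_vec)
        then show "(A *\<^sub>v u) $ i = (a \<cdot>\<^sub>v u) $ i" using i u A by simp
      qed (use A u in simp)
      then show ?thesis using u False inv[of as] u_def by blast
    qed
  qed
  moreover obtain as where "shift_chain A as v = 0\<^sub>v n"
    using shift_chain_annihilates[OF A] v(1) by metis
  ultimately show ?thesis using that by blast
qed

lemma shift_chain_eigenvector:
  assumes A: "A \<in> carrier_mat n n" and v: "v \<in> carrier_vec n" and ev: "A *\<^sub>v v = m \<cdot>\<^sub>v v"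
  shows "shift_chain A as v = (\<Prod>a\<leftarrow>as. m - a) \<cdot>\<^sub>v v"
proof (induction as)
  case (Cons a as)
  have "A *\<^sub>v ((\<Prod>a\<leftarrow>as. m - a) \<cdot>\<^sub>v v) = (\<Prod>a\<leftarrow>as. m - a) \<cdot>\<^sub>v (m \<cdot>\<^sub>v v)"
    using A v by (simp add: mult_mat_vec[of A n n] ev)
  then show ?case
    using Cons v by (intro eq_vecI) (simp_all add: algebra_simps)
qed (use v in simp)

section \<open>Free polynomials in one variable, scalar points and spectra\<close>

lemma singleton_nc_level:
  "A \<in> carrier_mat n n \<Longrightarrow> [A] \<in> nc_level 1 n"
  by (simp add: nc_level_def)

lemma nc_size_singleton: "A \<in> carrier_mat n n \<Longrightarrow> nc_size [A] = n"
  by (simp add: nc_size_def)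

lemma free_poly_eval_carrier: "free_poly_eval x p \<in> carrier_mat (nc_size x) (nc_size x)"
  by (simp add: free_poly_eval_def)

lemma free_poly_eval_index:
  assumes "i < nc_size x" "j < nc_size x" "finite S" "Poly_Mapping.keys p \<subseteq> S"
  shows "free_poly_eval x p $$ (i, j) = (\<Sum>w\<in>S. Poly_Mapping.lookup p w * word_eval x w $$ (i, j))"
proof -
  have "(\<Sum>w\<in>Poly_Mapping.keys p. Poly_Mapping.lookup p w * word_eval x w $$ (i, j))
      = (\<Sum>w\<in>S. Poly_Mapping.lookup p w * word_eval x w $$ (i, j))"
    by (rule sum.mono_neutral_left) (use assms in \<open>auto simp: in_keys_iff\<close>)
  then show ?thesis using assms by (simp add: free_poly_eval_def)
qed

lemma free_poly_eval_single:
  assumes "i < nc_size x" "j < nc_size x"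
  shows "free_poly_eval x (Poly_Mapping.single w c) $$ (i, j) = c * word_eval x w $$ (i, j)"
  using free_poly_eval_index[OF assms, of "{w}"] by simp

lemma free_poly_eval_add:
  assumes "i < nc_size x" "j < nc_size x"
  shows "free_poly_eval x (p + q) $$ (i, j) = free_poly_eval x p $$ (i, j) + free_poly_eval x q $$ (i, j)"
proof -
  let ?S = "Poly_Mapping.keys p \<union> Poly_Mapping.keys q"
  have "free_poly_eval x (p + q) $$ (i, j) = (\<Sum>w\<in>?S. Poly_Mapping.lookup (p + q) w * word_eval x w $$ (i, j))"
    by (rule free_poly_eval_index) (use assms keys_add[of p q] in auto)
  moreover have "free_poly_eval x p $$ (i, j) = (\<Sum>w\<in>?S. Poly_Mapping.lookup p w * word_eval x w $$ (i, j))"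
    by (rule free_poly_eval_index) (use assms in auto)
  moreover have "free_poly_eval x q $$ (i, j) = (\<Sum>w\<in>?S. Poly_Mapping.lookup q w * word_eval x w $$ (i, j))"
    by (rule free_poly_eval_index) (use assms in auto)
  ultimately show ?thesis by (simp add: lookup_add distrib_right sum.distrib)
qed

lemma free_poly_eval_sum:
  assumes "i < nc_size x" "j < nc_size x" "finite S"
  shows "free_poly_eval x (\<Sum>s\<in>S. p s) $$ (i, j) = (\<Sum>s\<in>S. free_poly_eval x (p s) $$ (i, j))"
  using assms(3)
  by (induction S rule: finite_induct) (use assms in \<open>auto simp: free_poly_eval_zero free_poly_eval_add\<close>)

lemma free_poly_vars_add:
  "free_poly_vars d p \<Longrightarrow> free_poly_vars d q \<Longrightarrow> free_poly_vars d (p + q)"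
  using keys_add[of p q] by (auto simp: free_poly_vars_def)

lemma free_poly_vars_sum:
  assumes "\<And>s. s \<in> S \<Longrightarrow> free_poly_vars d (p s)"
  shows "free_poly_vars d (\<Sum>s\<in>S. p s)"
  using assms
  by (induction S rule: infinite_finite_induct) (auto intro!: free_poly_vars_add simp: free_poly_vars_def[of d 0])

lemma free_poly_vars_single: "set w \<subseteq> {..<d} \<Longrightarrow> free_poly_vars d (Poly_Mapping.single w c)"
  by (simp add: free_poly_vars_def)

lemma smult_mult_mat_vec:
  fixes A :: "'a::comm_ring_1 mat"
  assumes "v \<in> carrier_vec (dim_col A)"
  shows "(c \<cdot>\<^sub>m A) *\<^sub>v v = c \<cdot>\<^sub>v (A *\<^sub>v v)"
  using assms by (intro eq_vecI) simp_all

text \<open>The polynomial is \<open>K\<close> times the product of the factors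
  \<open>X - a\<close>. A basic free set imposes one inequality on matrices of all sizes, so a
  single \<open>p\<close> has to serve for every \<open>n\<close>, \<open>A\<close> and
  \<open>v\<close>.\<close>

lemma exists_free_poly_shift_chain:
  obtains p where "free_poly_vars 1 p"
    "\<And>n A v. A \<in> carrier_mat n n \<Longrightarrow> v \<in> carrier_vec n \<Longrightarrow>
       free_poly_eval [A] p *\<^sub>v v = K \<cdot>\<^sub>v shift_chain A as v"
proof -
  have "\<exists>p. free_poly_vars 1 p \<and> (\<forall>n A v. A \<in> carrier_mat n n \<longrightarrow> v \<in> carrier_vec n \<longrightarrow>
       free_poly_eval [A] p *\<^sub>v v = K \<cdot>\<^sub>v shift_chain A as v)"
  proof (induction as)
    case Nil
    have "free_poly_eval [A] (Poly_Mapping.single [] K) *\<^sub>v v = K \<cdot>\<^sub>v shift_chain A [] v"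
      if A: "A \<in> carrier_mat n n" and v: "v \<in> carrier_vec n" for n A v
    proof -
      have "free_poly_eval [A] (Poly_Mapping.single [] K) = K \<cdot>\<^sub>m 1\<^sub>m n"
      proof (rule eq_matI)
        fix i j assume "i < dim_row (K \<cdot>\<^sub>m 1\<^sub>m n)" "j < dim_col (K \<cdot>\<^sub>m 1\<^sub>m n)"
        then show "free_poly_eval [A] (Poly_Mapping.single [] K) $$ (i, j) = (K \<cdot>\<^sub>m 1\<^sub>m n) $$ (i, j)"
          using free_poly_eval_single[of i "[A]" j "[]" K] nc_size_singleton[OF A]
          by (simp add: word_eval_def)
      qed (use nc_size_singleton[OF A] in \<open>simp_all add: free_poly_eval_def\<close>)
      then show ?thesis using v by (simp add: smult_mult_mat_vec)
    qed
    moreover have "free_poly_vars 1 (Poly_Mapping.single [] K)" by (simp add: free_poly_vars_single)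
    ultimately show ?case by blast
  next
    case (Cons a as)
    then obtain p where p: "free_poly_vars 1 p" and ev: "\<forall>n A v. A \<in> carrier_mat n n \<longrightarrow> v \<in> carrier_vec n \<longrightarrow>
       free_poly_eval [A] p *\<^sub>v v = K \<cdot>\<^sub>v shift_chain A as v" by blast
    \<comment> \<open>Prefixing the letter 0 to every word is multiplication by \<open>X\<close>
      from the left, so \<open>q\<close> is \<open>X p - a p\<close>.\<close>
    define q where "q = (\<Sum>w\<in>Poly_Mapping.keys p. Poly_Mapping.single (0 # w) (Poly_Mapping.lookup p w)
        + Poly_Mapping.single w (- a * Poly_Mapping.lookup p w))"
    have q: "free_poly_vars 1 q"
      unfolding q_def using p
      by (intro free_poly_vars_sum free_poly_vars_add free_poly_vars_single) (auto simp: free_poly_vars_def)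
    have "free_poly_eval [A] q *\<^sub>v v = K \<cdot>\<^sub>v shift_chain A (a # as) v"
      if A: "A \<in> carrier_mat n n" and v: "v \<in> carrier_vec n" for n A v
    proof -
      let ?E = "free_poly_eval [A] p"
      have size: "nc_size [A] = n" by (rule nc_size_singleton[OF A])
      have E: "?E \<in> carrier_mat n n" using free_poly_eval_carrier[of "[A]" p] by (simp add: size)
      have "free_poly_eval [A] q = A * ?E - a \<cdot>\<^sub>m ?E"
      proof (rule eq_matI)
        fix i j assume "i < dim_row (A * ?E - a \<cdot>\<^sub>m ?E)" "j < dim_col (A * ?E - a \<cdot>\<^sub>m ?E)"
        then have ij: "i < n" "j < n" using A E by auto
        have "free_poly_eval [A] q $$ (i, j) = (\<Sum>w\<in>Poly_Mapping.keys p.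
            Poly_Mapping.lookup p w * word_eval [A] (0 # w) $$ (i, j) - a * (Poly_Mapping.lookup p w * word_eval [A] w $$ (i, j)))"
          unfolding q_def using ij
          by (simp add: free_poly_eval_sum free_poly_eval_add free_poly_eval_single size mult.assoc)
        also have "\<dots> = (\<Sum>w\<in>Poly_Mapping.keys p. Poly_Mapping.lookup p w * (\<Sum>k<n. A $$ (i, k) * word_eval [A] w $$ (k, j)))
            - a * ?E $$ (i, j)"
        proof -
          have "word_eval [A] (0 # w) $$ (i, j) = (\<Sum>k<n. A $$ (i, k) * word_eval [A] w $$ (k, j))"
            if "w \<in> Poly_Mapping.keys p" for w
          proof -
            have "word_eval [A] w \<in> carrier_mat n n"
              using that p by (intro word_eval_carrier[OF singleton_nc_level[OF A]]) (auto simp: free_poly_vars_def)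
            moreover have "word_eval [A] (0 # w) = A * word_eval [A] w" by (simp add: word_eval_def)
            ultimately show ?thesis using A ij by (simp add: scalar_prod_def atLeast0LessThan)
          qed
          then show ?thesis using ij by (simp add: sum_subtractf sum_distrib_left free_poly_eval_def size)
        qed
        also have "(\<Sum>w\<in>Poly_Mapping.keys p. Poly_Mapping.lookup p w * (\<Sum>k<n. A $$ (i, k) * word_eval [A] w $$ (k, j)))
            = (\<Sum>k<n. A $$ (i, k) * ?E $$ (k, j))"
          using ij by (simp add: free_poly_eval_def size sum_distrib_left mult.left_commute sum.swap[of _ "Poly_Mapping.keys p"])
        finally show "free_poly_eval [A] q $$ (i, j) = (A * ?E - a \<cdot>\<^sub>m ?E) $$ (i, j)"
          using ij A E by (simp add: scalar_prod_def atLeast0LessThan)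
      qed (use A E in \<open>simp_all add: free_poly_eval_def size\<close>)
      then have "free_poly_eval [A] q *\<^sub>v v = A *\<^sub>v (?E *\<^sub>v v) - a \<cdot>\<^sub>v (?E *\<^sub>v v)"
        using A E v
        by (simp add: minus_mult_distrib_mat_vec[of _ n n] assoc_mult_mat_vec[of A n n ?E n]
            smult_mult_mat_vec)
      also have "?E *\<^sub>v v = K \<cdot>\<^sub>v shift_chain A as v" using ev A v by blast
      finally show ?thesis
        using A shift_chain_carrier[OF A v, of as]
        by (intro eq_vecI) (simp_all add: mult_mat_vec[of A n n] algebra_simps)
    qed
    then show ?case using q by blast
  qed
  then show ?thesis using that by blast
qed

abbreviation scalar_point :: "complex \<Rightarrow> nc_point" where
  "scalar_point m \<equiv> [mat (Suc 0) (Suc 0) (\<lambda>_. m)]"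

lemma scalar_point_nc_level: "scalar_point m \<in> nc_level 1 1"
  by (rule singleton_nc_level) simp

lemma nc_size_scalar_point: "nc_size (scalar_point m) = 1"
  by (simp add: nc_size_def)

lemma singleton_nc_universe:
  assumes "A \<in> carrier_mat n n" "0 < n"
  shows "[A] \<in> nc_universe 1"
  using singleton_nc_level[OF assms(1)] assms nc_size_singleton[OF assms(1)] by (simp add: nc_universe_iff)

lemma nc_universe_1E:
  assumes "x \<in> nc_universe 1"
  obtains A n where "x = [A]" "A \<in> carrier_mat n n" "0 < n"
proof -
  have x: "0 < nc_size x" "x \<in> nc_level 1 (nc_size x)" using assms by (simp_all add: nc_universe_iff)
  then obtain A where "x = [A]" by (auto simp: nc_level_def length_Suc_conv)
  then show ?thesis using that[of A "nc_size x"] x by (simp add: nc_level_def)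
qed

lemma free_poly_eval_eigenvector:
  assumes A: "A \<in> carrier_mat n n" and v: "v \<in> carrier_vec n" and ev: "A *\<^sub>v v = m \<cdot>\<^sub>v v"
    and p: "free_poly_vars 1 p"
  shows "free_poly_eval [A] p *\<^sub>v v = free_poly_eval (scalar_point m) p $$ (0, 0) \<cdot>\<^sub>v v"
proof -
  have word: "word_eval [A] w *\<^sub>v v = word_eval (scalar_point m) w $$ (0, 0) \<cdot>\<^sub>v v" if "set w \<subseteq> {..<1}" for w
    using that
  proof (induction w)
    case Nil
    then show ?case using nc_size_singleton[OF A] nc_size_scalar_point[of m] v by (simp add: word_eval_def)
  next
    case (Cons i w)
    then have i: "i = 0" and w: "set w \<subseteq> {..<1}" by auto
    have W: "word_eval [A] w \<in> carrier_mat n n" "word_eval (scalar_point m) w \<in> carrier_mat 1 1"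
      using word_eval_carrier[OF singleton_nc_level[OF A] _ w] word_eval_carrier[OF scalar_point_nc_level _ w]
      by simp_all
    define c where "c = word_eval (scalar_point m) w $$ (0, 0)"
    have "word_eval [A] (i # w) *\<^sub>v v = A *\<^sub>v (word_eval [A] w *\<^sub>v v)"
      using A v W(1) i by (simp add: word_eval_def assoc_mult_mat_vec[of A n n _ n])
    also have "\<dots> = c \<cdot>\<^sub>v (m \<cdot>\<^sub>v v)"
      using Cons.IH[OF w] A v by (simp add: c_def mult_mat_vec[of A n n] ev)
    also have "\<dots> = (m * c) \<cdot>\<^sub>v v" by (simp add: smult_smult_assoc mult.commute)
    also have "m * c = word_eval (scalar_point m) (i # w) $$ (0, 0)"
      using W(2) i by (simp add: word_eval_def c_def scalar_prod_def)
    finally show ?case .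
  qed
  have size: "nc_size [A] = n" by (rule nc_size_singleton[OF A])
  show ?thesis
  proof (rule eq_vecI)
    fix k assume "k < dim_vec (free_poly_eval (scalar_point m) p $$ (0, 0) \<cdot>\<^sub>v v)"
    then have k: "k < n" using v by simp
    have word_sum: "(\<Sum>l<n. word_eval [A] w $$ (k, l) * v $ l) = word_eval (scalar_point m) w $$ (0, 0) * v $ k"
      if w: "w \<in> Poly_Mapping.keys p" for w
    proof -
      have w: "set w \<subseteq> {..<1}" using w p by (auto simp: free_poly_vars_def)
      have "word_eval [A] w \<in> carrier_mat n n"
        using word_eval_carrier[OF singleton_nc_level[OF A] _ w] by simp
      then have "(word_eval [A] w *\<^sub>v v) $ k = (\<Sum>l<n. word_eval [A] w $$ (k, l) * v $ l)"
        using k v by (simp add: scalar_prod_def atLeast0LessThan)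
      then show ?thesis using word[OF w] k v by simp
    qed
    have "(free_poly_eval [A] p *\<^sub>v v) $ k
        = (\<Sum>l<n. \<Sum>w\<in>Poly_Mapping.keys p. Poly_Mapping.lookup p w * (word_eval [A] w $$ (k, l) * v $ l))"
      using k v by (simp add: free_poly_eval_def size scalar_prod_def atLeast0LessThan sum_distrib_right mult.assoc)
    also have "\<dots> = (\<Sum>w\<in>Poly_Mapping.keys p. Poly_Mapping.lookup p w * (\<Sum>l<n. word_eval [A] w $$ (k, l) * v $ l))"
      by (subst sum.swap) (simp add: sum_distrib_left)
    also have "\<dots> = (\<Sum>w\<in>Poly_Mapping.keys p. Poly_Mapping.lookup p w * (word_eval (scalar_point m) w $$ (0, 0) * v $ k))"
      using word_sum by simp
    also have "\<dots> = free_poly_eval (scalar_point m) p $$ (0, 0) * v $ k"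
      using nc_size_scalar_point[of m] by (simp add: free_poly_eval_def sum_distrib_right mult.assoc)
    finally show "(free_poly_eval [A] p *\<^sub>v v) $ k = (free_poly_eval (scalar_point m) p $$ (0, 0) \<cdot>\<^sub>v v) $ k"
      using k v by simp
  qed (use v in \<open>simp add: free_poly_eval_def size\<close>)
qed

text \<open>On a tensor product of a vector \<open>u\<close> of scalars with the eigenvector
  \<open>v\<close>, the value of \<open>\<delta>\<close> at \<open>A\<close> acts as its value at
  \<open>m\<close> on \<open>u\<close> and keeps \<open>v\<close>. Both sides of the inequality for
  \<open>A\<close> are therefore those for \<open>m\<close> times the positive factor
  \<open>V\<close>, the squared norm of \<open>v\<close>.\<close>

lemma scalar_point_mem_basic_free_set:
  assumes A: "A \<in> carrier_mat n n" "[A] \<in> basic_free_set 1 \<delta>" and \<delta>: "free_poly_mat 1 \<delta>"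
    and v: "v \<in> carrier_vec n" "v \<noteq> 0\<^sub>v n" and ev: "A *\<^sub>v v = m \<cdot>\<^sub>v v"
  shows "scalar_point m \<in> basic_free_set 1 \<delta>"
proof -
  have one_pos: "0 < (1::nat)" by simp
  have uni: "[A] \<in> nc_universe 1" using A(2) by (simp add: basic_free_set_def)
  have size: "nc_size [A] = n" by (rule nc_size_singleton[OF A(1)])
  have uni1: "scalar_point m \<in> nc_universe 1" by (rule singleton_nc_universe[of _ 1]) simp_all
  define V where "V = (\<Sum>l<n. (cmod (v $ l))\<^sup>2)"
  obtain k where k: "k < n" "v $ k \<noteq> 0"
  proof (rule ccontr)
    assume "\<not> thesis"
    then have "v = 0\<^sub>v n" using v(1) that by (intro eq_vecI) auto
    then show False using v(2) by simp
  qed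
  have V: "0 < V"
    unfolding V_def by (rule sum_pos2[of _ k]) (use k in auto)
  obtain c where c: "0 \<le> c" "c < 1"
    and le: "\<And>w. block_sq \<delta> [A] w \<le> c * (\<Sum>j<dim_col \<delta>. \<Sum>l<n. (cmod (w j l))\<^sup>2)"
    using A(2) mem_basic_free_set_iff[OF uni one_pos] by (auto simp: size)
  have "block_sq \<delta> (scalar_point m) u \<le> c * (\<Sum>j<dim_col \<delta>. \<Sum>l<nc_size (scalar_point m). (cmod (u j l))\<^sup>2)" for u
  proof -
    let ?w = "\<lambda>j l. u j 0 * v $ l" and ?p = "\<lambda>i j. free_poly_eval (scalar_point m) (\<delta> $$ (i, j)) $$ (0, 0)"
    have inner: "(\<Sum>l<n. free_poly_eval [A] (\<delta> $$ (i, j)) $$ (k, l) * ?w j l) = ?p i j * u j 0 * v $ k"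
      if ij: "i < dim_row \<delta>" "j < dim_col \<delta>" and k: "k < n" for i j k
    proof -
      have "free_poly_vars 1 (\<delta> $$ (i, j))"
        using \<delta> ij elements_matI[of \<delta> "dim_row \<delta>" "dim_col \<delta>" i j] by (simp add: free_poly_mat_def)
      then have "(free_poly_eval [A] (\<delta> $$ (i, j)) *\<^sub>v v) $ k = (?p i j \<cdot>\<^sub>v v) $ k"
        using free_poly_eval_eigenvector[OF A(1) v(1) ev] by simp
      moreover have "(free_poly_eval [A] (\<delta> $$ (i, j)) *\<^sub>v v) $ k
          = (\<Sum>l<n. free_poly_eval [A] (\<delta> $$ (i, j)) $$ (k, l) * v $ l)"
        using k v(1) free_poly_eval_carrier[of "[A]" "\<delta> $$ (i, j)"]
        by (simp add: size scalar_prod_def atLeast0LessThan)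
      ultimately have "(\<Sum>l<n. free_poly_eval [A] (\<delta> $$ (i, j)) $$ (k, l) * v $ l) = ?p i j * v $ k"
        using k v(1) by simp
      then have "u j 0 * (\<Sum>l<n. free_poly_eval [A] (\<delta> $$ (i, j)) $$ (k, l) * v $ l) = u j 0 * (?p i j * v $ k)"
        by simp
      then show ?thesis by (simp add: sum_distrib_left mult_ac)
    qed
    have "block_sq \<delta> [A] ?w = (\<Sum>i<dim_row \<delta>. \<Sum>k<n. (cmod (\<Sum>j<dim_col \<delta>. ?p i j * u j 0 * v $ k))\<^sup>2)"
      unfolding block_sq_def size using inner by simp
    also have "\<dots> = (\<Sum>i<dim_row \<delta>. \<Sum>k<n. (cmod (\<Sum>j<dim_col \<delta>. ?p i j * u j 0))\<^sup>2 * (cmod (v $ k))\<^sup>2)"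
      by (simp add: sum_distrib_right[symmetric] norm_mult power_mult_distrib)
    also have "\<dots> = block_sq \<delta> (scalar_point m) u * V"
      by (simp add: block_sq_def nc_size_scalar_point V_def sum_distrib_left[symmetric] sum_distrib_right[symmetric])
    finally have "block_sq \<delta> (scalar_point m) u * V = block_sq \<delta> [A] ?w" by simp
    also have "\<dots> \<le> c * (\<Sum>j<dim_col \<delta>. \<Sum>l<n. (cmod (?w j l))\<^sup>2)" by (rule le)
    also have "\<dots> = c * (\<Sum>j<dim_col \<delta>. (cmod (u j 0))\<^sup>2) * V"
      by (simp add: V_def norm_mult power_mult_distrib sum_distrib_left[symmetric] sum_distrib_right[symmetric])
    finally show ?thesis using V by (simp add: nc_size_scalar_point)
  qed
  then show ?thesis using c mem_basic_free_set_iff[OF uni1 one_pos] by blast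
qed

lemma free_poly_mat_eval_1x1:
  assumes "0 < nc_size x"
  shows "free_poly_mat_eval (mat 1 1 (\<lambda>_. p)) x = free_poly_eval x p"
  using assms by (intro eq_matI) (auto simp: free_poly_mat_eval_def Let_def free_poly_eval_def)

lemma norm_prod_list_ge_power:
  fixes f :: "'a \<Rightarrow> complex"
  assumes "0 \<le> r" "\<And>a. a \<in> set as \<Longrightarrow> r \<le> cmod (f a)"
  shows "r ^ length as \<le> cmod (\<Prod>a\<leftarrow>as. f a)"
  using assms by (induction as) (auto simp: norm_mult intro!: mult_mono)

text \<open>A polynomial that vanishes at \<open>A\<close> keeps \<open>A\<close> in its basic free
  set whatever constant multiplies it. The constant can thus be taken so large that every scalar far
  from the spectrum of \<open>A\<close> is expelled.\<close>

lemma exists_basic_free_set_eigenvalues: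
  assumes A: "A \<in> carrier_mat n n" "0 < n" and r: "\<And>e. eigenvalue A e \<Longrightarrow> 0 < (r e :: real)"
  obtains \<delta> where "free_poly_mat 1 \<delta>" "[A] \<in> basic_free_set 1 \<delta>"
    "\<And>m. scalar_point m \<in> basic_free_set 1 \<delta> \<Longrightarrow> \<exists>e. eigenvalue A e \<and> cmod (m - e) < r e"
proof -
  obtain as where as: "\<And>a. a \<in> set as \<Longrightarrow> eigenvalue A a"
    "\<And>v. v \<in> carrier_vec n \<Longrightarrow> shift_chain A as v = 0\<^sub>v n"
    using shift_chain_annihilates[OF A(1)] by metis
  \<comment> \<open>A common radius for the finitely many roots in \<open>as\<close>; the extra 1
    makes the minimum positive for any list. If a scalar has distance at least \<open>\<rho>\<close>
    from all roots, the product of the factors is at least \<open>\<rho> ^ length as\<close>, which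
    the constant in \<open>p\<close> scales to 1.\<close>
  define \<rho> where "\<rho> = Min (insert 1 (r ` set as))"
  have \<rho>: "0 < \<rho>" using r as(1) by (auto simp: \<rho>_def)
  have \<rho>_le: "\<rho> \<le> r a" if "a \<in> set as" for a using that by (auto simp: \<rho>_def)
  obtain p where p: "free_poly_vars 1 p"
    and ev: "\<And>n A v. A \<in> carrier_mat n n \<Longrightarrow> v \<in> carrier_vec n \<Longrightarrow>
       free_poly_eval [A] p *\<^sub>v v = complex_of_real (1 / \<rho> ^ length as) \<cdot>\<^sub>v shift_chain A as v"
    using exists_free_poly_shift_chain[of "complex_of_real (1 / \<rho> ^ length as)" as] by metis
  let ?\<delta> = "mat 1 1 (\<lambda>_. p)"
  have "free_poly_mat 1 ?\<delta>" using p by (auto simp: free_poly_mat_def)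
  moreover have "[A] \<in> basic_free_set 1 ?\<delta>"
  proof -
    have size: "nc_size [A] = n" by (rule nc_size_singleton[OF A(1)])
    have "mat_op_norm (free_poly_eval [A] p) \<le> 0"
    proof (rule mat_op_norm_le)
      fix v :: "complex vec"
      assume "v \<in> carrier_vec (dim_col (free_poly_eval [A] p))"
      then have v: "v \<in> carrier_vec n" by (simp add: free_poly_eval_def size)
      have "free_poly_eval [A] p *\<^sub>v v = 0\<^sub>v n"
        unfolding ev[OF A(1) v] as(2)[OF v] by (intro eq_vecI) auto
      then show "vec_l2_norm (free_poly_eval [A] p *\<^sub>v v) \<le> 0 * vec_l2_norm v"
        by (simp add: vec_l2_norm_def L2_set_def)
    qed simp
    then show ?thesis
      using singleton_nc_universe[OF A] free_poly_mat_eval_1x1[of "[A]" p] A(2)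
      by (simp add: basic_free_set_def size)
  qed
  moreover have "\<exists>e. eigenvalue A e \<and> cmod (m - e) < r e" if m: "scalar_point m \<in> basic_free_set 1 ?\<delta>" for m
  proof (rule ccontr)
    assume "\<not> (\<exists>e. eigenvalue A e \<and> cmod (m - e) < r e)"
    then have "\<rho> \<le> cmod (m - a)" if "a \<in> set as" for a
      using as(1)[OF that] \<rho>_le[OF that] by (meson linorder_not_less order_trans)
    then have ge: "\<rho> ^ length as \<le> cmod (\<Prod>a\<leftarrow>as. m - a)"
      using \<rho> by (intro norm_prod_list_ge_power) auto
    let ?M = "mat (Suc 0) (Suc 0) (\<lambda>_. m)" and ?u = "vec (Suc 0) (\<lambda>_. 1) :: complex vec"
    have "?M *\<^sub>v ?u = m \<cdot>\<^sub>v ?u" by (intro eq_vecI) (auto simp: scalar_prod_def)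
    then have chain: "shift_chain ?M as ?u = (\<Prod>a\<leftarrow>as. m - a) \<cdot>\<^sub>v ?u"
      by (intro shift_chain_eigenvector[of _ 1]) auto
    have E: "free_poly_eval (scalar_point m) p \<in> carrier_mat 1 1"
      using free_poly_eval_carrier[of "scalar_point m" p] by (simp add: nc_size_scalar_point)
    have "(free_poly_eval (scalar_point m) p *\<^sub>v ?u) $ 0
        = complex_of_real (1 / \<rho> ^ length as) * (\<Prod>a\<leftarrow>as. m - a)"
      using ev[of ?M 1 ?u] by (simp add: chain)
    moreover have "(free_poly_eval (scalar_point m) p *\<^sub>v ?u) $ 0 = free_poly_eval (scalar_point m) p $$ (0, 0)"
      using E by (simp add: scalar_prod_def)
    ultimately have "cmod (free_poly_eval (scalar_point m) p $$ (0, 0))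
        = cmod (\<Prod>a\<leftarrow>as. m - a) / \<rho> ^ length as"
      using \<rho> by (simp add: norm_mult norm_divide norm_power)
    then have "1 \<le> cmod (free_poly_eval (scalar_point m) p $$ (0, 0))"
      using ge \<rho> by simp
    also have "\<dots> \<le> mat_op_norm (free_poly_eval (scalar_point m) p)"
      using E by (intro cmod_index_le_mat_op_norm) auto
    also have "\<dots> < 1"
      using m free_poly_mat_eval_1x1[of "scalar_point m" p]
      by (simp add: basic_free_set_def nc_size_scalar_point)
    finally show False by simp
  qed
  ultimately show ?thesis using that by blast
qed

section \<open>Entrywise openness of basic free sets\<close>

lemma tendsto_word_eval:
  assumes M: "\<And>q. M q \<in> carrier_mat n n" and A: "A \<in> carrier_mat n n"
    and lim: "\<And>i j. i < n \<Longrightarrow> j < n \<Longrightarrow> ((\<lambda>q. M q $$ (i, j)) \<longlongrightarrow> A $$ (i, j)) F"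
    and w: "set w \<subseteq> {..<1}" and ij: "i < n" "j < n"
  shows "((\<lambda>q. word_eval [M q] w $$ (i, j)) \<longlongrightarrow> word_eval [A] w $$ (i, j)) F"
  using w ij
proof (induction w arbitrary: i j)
  case Nil
  then show ?case by (simp add: word_eval_def nc_size_singleton[OF M] nc_size_singleton[OF A])
next
  case (Cons a w)
  then have a: "a = 0" and w: "set w \<subseteq> {..<1}" by auto
  have step: "word_eval [B] (a # w) $$ (i, j) = (\<Sum>k<n. B $$ (i, k) * word_eval [B] w $$ (k, j))"
    if B: "B \<in> carrier_mat n n" for B
  proof -
    have "word_eval [B] w \<in> carrier_mat n n"
      using word_eval_carrier[OF singleton_nc_level[OF B] _ w] by simp
    moreover have "word_eval [B] (a # w) = B * word_eval [B] w" by (simp add: word_eval_def a)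
    ultimately show ?thesis using B Cons.prems by (simp add: scalar_prod_def atLeast0LessThan)
  qed
  show ?case
    unfolding step[OF M] step[OF A]
    by (intro tendsto_sum tendsto_mult lim Cons.IH) (use w Cons.prems in auto)
qed

text \<open>At each fixed matrix size a basic free set is open in the usual topology, since the
  entries of the value of \<open>\<delta>\<close> are polynomials in the entries of the matrix. The
  general filter \<open>F\<close> admits a family with two independent parameters.\<close>

lemma eventually_mem_basic_free_set:
  assumes M: "\<And>q. M q \<in> carrier_mat n n" and A: "A \<in> carrier_mat n n"
    and lim: "\<And>i j. i < n \<Longrightarrow> j < n \<Longrightarrow> ((\<lambda>q. M q $$ (i, j)) \<longlongrightarrow> A $$ (i, j)) F"
    and \<delta>: "free_poly_mat 1 \<delta>" and mem: "[A] \<in> basic_free_set 1 \<delta>"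
  shows "eventually (\<lambda>q. [M q] \<in> basic_free_set 1 \<delta>) F"
proof -
  have "[A] \<in> nc_universe 1" using mem by (simp add: basic_free_set_def)
  then have n: "0 < n" using nc_size_pos[of "[A]" 1] nc_size_singleton[OF A] by simp
  note sizeM = nc_size_singleton[OF M] and sizeA = nc_size_singleton[OF A]
  let ?E = "\<lambda>B. free_poly_mat_eval \<delta> [B]"
  have car: "?E B \<in> carrier_mat (dim_row \<delta> * n) (dim_col \<delta> * n)" if "B \<in> carrier_mat n n" for B
    using nc_size_singleton[OF that] by (simp add: free_poly_mat_eval_def Let_def)
  have "((\<lambda>q. ?E (M q) $$ (r, c)) \<longlongrightarrow> ?E A $$ (r, c)) F"
    if rc: "r < dim_row \<delta> * n" "c < dim_col \<delta> * n" for r c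
  proof -
    let ?p = "\<delta> $$ (r div n, c div n)"
    have "r div n < dim_row \<delta>" "c div n < dim_col \<delta>" using rc by (simp_all add: less_mult_imp_div_less)
    then have p: "free_poly_vars 1 ?p"
      using \<delta> elements_matI[of \<delta> "dim_row \<delta>" "dim_col \<delta>" "r div n" "c div n"] by (simp add: free_poly_mat_def)
    have eq: "?E B $$ (r, c) = (\<Sum>w\<in>Poly_Mapping.keys ?p. Poly_Mapping.lookup ?p w * word_eval [B] w $$ (r mod n, c mod n))"
      if "B \<in> carrier_mat n n" for B
      using rc n nc_size_singleton[OF that] by (simp add: free_poly_mat_eval_def Let_def free_poly_eval_def)
    show ?thesis
      unfolding eq[OF M] eq[OF A]
      by (intro tendsto_sum tendsto_mult tendsto_const tendsto_word_eval[OF M A lim])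
        (use p n in \<open>auto simp: free_poly_vars_def\<close>)
  qed
  then have "((\<lambda>q. mat_op_norm (?E A) + (\<Sum>r<dim_row \<delta> * n. \<Sum>c<dim_col \<delta> * n. cmod (?E (M q) $$ (r, c) - ?E A $$ (r, c))))
      \<longlongrightarrow> mat_op_norm (?E A) + (\<Sum>r<dim_row \<delta> * n. \<Sum>c<dim_col \<delta> * n. cmod (?E A $$ (r, c) - ?E A $$ (r, c)))) F"
    by (intro tendsto_add tendsto_const tendsto_sum tendsto_norm tendsto_diff) auto
  moreover have "mat_op_norm (?E A) < 1" using mem by (simp add: basic_free_set_def)
  ultimately have "eventually (\<lambda>q. mat_op_norm (?E A)
      + (\<Sum>r<dim_row \<delta> * n. \<Sum>c<dim_col \<delta> * n. cmod (?E (M q) $$ (r, c) - ?E A $$ (r, c))) < 1) F"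
    by (intro order_tendstoD(2)) auto
  then show ?thesis
  proof eventually_elim
    case (elim q)
    then have "mat_op_norm (?E (M q)) < 1"
      using mat_op_norm_le_perturb[OF car[OF M] car[OF A], of q] by linarith
    then show ?case using singleton_nc_universe[OF M n] by (simp add: basic_free_set_def)
  qed
qed

section \<open>Nc-functions and intertwining matrices\<close>

lemma nc_function_subset:
  assumes "nc_function d D f" "nc_set d C" "C \<subseteq> D"
  shows "nc_function d C f"
  using assms unfolding nc_function_def graded_def by (meson IntD1 IntD2 IntI subsetD)

lemma nc_function_carrier:
  assumes "nc_function 1 D f" "[A] \<in> D" "A \<in> carrier_mat n n"
  shows "f [A] \<in> carrier_mat n n" and "0 < n"
proof -
  have "[A] \<in> nc_universe 1" using assms by (auto simp: nc_function_def nc_set_def)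
  then show "0 < n" using nc_size_pos[of "[A]" 1] nc_size_singleton[OF assms(3)] by simp
  then show "f [A] \<in> carrier_mat n n"
    using assms singleton_nc_level[OF assms(3)] by (simp add: nc_function_def graded_def)
qed

text \<open>If \<open>L\<close> intertwines \<open>A\<close> and \<open>B\<close>, then \<open>A \<oplus> B\<close> is fixed by the similarity with the unipotent
  block matrix whose lower left corner is \<open>L\<close>, so the value of \<open>f\<close> there is fixed as well.\<close>

lemma nc_function_intertwines:
  assumes f: "nc_function 1 D f" and A: "[A] \<in> D" "A \<in> carrier_mat n n"
    and B: "[B] \<in> D" "B \<in> carrier_mat m m" and L: "L \<in> carrier_mat m n" "L * A = B * L"
  shows "L * f [A] = f [B] * L"
proof -
  define s where "s K = four_block_mat (1\<^sub>m n) (0\<^sub>m n m) K (1\<^sub>m m)" for K :: "complex mat"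
  have scar: "s K \<in> carrier_mat (n + m) (n + m)" if "K \<in> carrier_mat m n" for K
    using that by (simp add: s_def)
  have left: "mat_dsum P Q * s K = four_block_mat P (0\<^sub>m n m) (Q * K) Q"
    and right: "s K * mat_dsum P Q = four_block_mat P (0\<^sub>m n m) (K * P) Q"
    if "P \<in> carrier_mat n n" "Q \<in> carrier_mat m m" "K \<in> carrier_mat m n" for P Q K
    using that unfolding s_def mat_dsum_def
    by (simp_all add: mult_four_block_mat[of _ n n _ m _ m _ _ n _ m]
        right_add_zero_mat[of _ n n] left_add_zero_mat[of _ m m] right_add_zero_mat[of _ m n] left_add_zero_mat[of _ m n])
  have neg_zero: "- 0\<^sub>m k k = (0\<^sub>m k k :: complex mat)" for k by (intro eq_matI) auto
  \<comment> \<open>Products of these unipotent matrices add their corners, so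
    \<open>s (- L)\<close> is the inverse of \<open>s L\<close>.\<close>
  have ss: "s K * s (- K) = 1\<^sub>m (n + m)" if "K \<in> carrier_mat m n" for K
    using that unfolding s_def
    by (simp add: mult_four_block_mat[of _ n n _ m _ m _ _ n _ m]
        right_add_zero_mat[of _ n n] left_add_zero_mat[of _ m m] add_uminus_minus_mat[of _ m n] neg_zero)
  have inv: "s L * s (- L) = 1\<^sub>m (n + m)" "s (- L) * s L = 1\<^sub>m (n + m)"
    using ss[of L] ss[of "- L"] L by simp_all
  let ?X = "mat_dsum A B"
  have X: "?X \<in> carrier_mat (n + m) (n + m)" by (rule mat_dsum_carrier) fact+
  have fA: "f [A] \<in> carrier_mat n n" "0 < n" and fB: "f [B] \<in> carrier_mat m m"
    using nc_function_carrier[OF f A] nc_function_carrier[OF f B] by simp_all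
  have dsum: "nc_dsum [A] [B] = [?X]" by (simp add: nc_dsum_def)
  have XD: "[?X] \<in> D" using f A B dsum by (metis nc_function_def nc_set_def)
  have fX: "f [?X] = mat_dsum (f [A]) (f [B])" using f A B dsum by (metis nc_function_def)
  have mL: "- L \<in> carrier_mat m n" using L by simp
  \<comment> \<open>The lower left corners of the two products are \<open>B * L\<close> and
    \<open>L * A\<close>, so this commutation is the intertwining relation itself.\<close>
  have "?X * s L = s L * ?X" using left[OF A(2) B(2) L(1)] right[OF A(2) B(2) L(1)] L(2) by simp
  then have "s (- L) * ?X * s L = (s (- L) * s L) * ?X"
    using scar[OF L(1)] scar[OF mL] X by (simp add: assoc_mult_mat[of _ "n+m" "n+m" _ "n+m" _ "n+m"])
  then have fixed: "s (- L) * ?X * s L = ?X" using inv X by simp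
  have "f (map (\<lambda>a. s (- L) * a * s L) [?X]) = s (- L) * f [?X] * s L"
  proof -
    have "inverts_mat (s L) (s (- L))" "inverts_mat (s (- L)) (s L)"
      using inv scar[OF L(1)] scar[OF mL] by (simp_all add: inverts_mat_def)
    moreover have "map (\<lambda>a. s (- L) * a * s L) [?X] \<in> D" using XD fixed by simp
    moreover have "[?X] \<in> D \<inter> nc_level 1 (n + m)" using XD singleton_nc_level[OF X] by simp
    moreover have "1 \<le> n + m" using fA by simp
    ultimately show ?thesis using f scar[OF L(1)] scar[OF mL] unfolding nc_function_def by blast
  qed
  then have F: "s (- L) * f [?X] * s L = f [?X]" using fixed by simp
  have FX: "f [?X] \<in> carrier_mat (n + m) (n + m)" unfolding fX by (rule mat_dsum_carrier[OF fA(1) fB])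
  have "s L * f [?X] = s L * (s (- L) * (f [?X] * s L))"
    using F scar[OF L(1)] scar[OF mL] FX by (simp add: assoc_mult_mat[of _ "n+m" "n+m" _ "n+m" _ "n+m"])
  also have "\<dots> = (s L * s (- L)) * (f [?X] * s L)"
    using scar[OF L(1)] scar[OF mL] FX by (simp add: assoc_mult_mat[of _ "n+m" "n+m" _ "n+m" _ "n+m"])
  also have "\<dots> = f [?X] * s L" using inv scar[OF L(1)] FX by simp
  finally have eq: "four_block_mat (f [A]) (0\<^sub>m n m) (L * f [A]) (f [B])
      = four_block_mat (f [A]) (0\<^sub>m n m) (f [B] * L) (f [B])"
    using left[OF fA(1) fB L(1)] right[OF fA(1) fB L(1)] fX by simp
  show ?thesis
  proof (rule eq_matI)
    fix i j assume ij: "i < dim_row (f [B] * L)" "j < dim_col (f [B] * L)"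
    then show "(L * f [A]) $$ (i, j) = (f [B] * L) $$ (i, j)"
      using arg_cong[OF eq, of "\<lambda>M. M $$ (n + i, j)"] fA(1) fB L(1) by simp
  qed (use fA fB L in auto)
qed

text \<open>An eigenvector, written as a matrix with one column, intertwines the scalar point of its
  eigenvalue with \<open>A\<close>.\<close>

lemma nc_function_eigenvector:
  assumes f: "nc_function 1 D f" and A: "[A] \<in> D" "A \<in> carrier_mat n n"
    and v: "v \<in> carrier_vec n" "A *\<^sub>v v = m \<cdot>\<^sub>v v" and m: "scalar_point m \<in> D"
  shows "f [A] *\<^sub>v v = f (scalar_point m) $$ (0, 0) \<cdot>\<^sub>v v"
proof -
  let ?L = "mat n 1 (\<lambda>(i, j). v $ i)" and ?M = "mat (Suc 0) (Suc 0) (\<lambda>_. m)"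
  have fA: "f [A] \<in> carrier_mat n n" by (rule nc_function_carrier[OF f A])
  have fm: "f (scalar_point m) \<in> carrier_mat 1 1"
    by (rule nc_function_carrier[OF f m]) simp
  have mult: "(B * ?L) $$ (i, 0) = (B *\<^sub>v v) $ i" if "i < n" "B \<in> carrier_mat n n" for B i
    using that v(1) by (simp add: scalar_prod_def)
  have "?L * ?M = A * ?L"
  proof (rule eq_matI)
    fix i j assume "i < dim_row (A * ?L)" "j < dim_col (A * ?L)"
    then have "i < n" "j = 0" using A by auto
    then show "(?L * ?M) $$ (i, j) = (A * ?L) $$ (i, j)"
      using mult[OF _ A(2), of i] v by (simp add: scalar_prod_def)
  qed (use A in auto)
  then have eq: "?L * f [?M] = f [A] * ?L"
    by (intro nc_function_intertwines[OF f m _ A, of 1]) auto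
  show ?thesis
  proof (rule eq_vecI)
    fix i assume "i < dim_vec (f (scalar_point m) $$ (0, 0) \<cdot>\<^sub>v v)"
    then have i: "i < n" using v(1) by simp
    have "(f [A] *\<^sub>v v) $ i = (?L * f [?M]) $$ (i, 0)" using mult[OF i fA] eq by simp
    also have "\<dots> = v $ i * f [?M] $$ (0, 0)" using i fm by (simp add: scalar_prod_def)
    finally show "(f [A] *\<^sub>v v) $ i = (f (scalar_point m) $$ (0, 0) \<cdot>\<^sub>v v) $ i"
      using i v(1) by simp
  qed (use v fA in simp)
qed

section \<open>Square roots at triangular matrices\<close>

definition upper_triangular_2 :: "complex \<Rightarrow> complex \<Rightarrow> complex \<Rightarrow> complex mat" where
  "upper_triangular_2 l c m =
     mat 2 2 (\<lambda>(i, j). if i = 0 then (if j = 0 then l else c) else (if j = 0 then 0 else m))"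

lemma upper_triangular_2_carrier [simp]: "upper_triangular_2 l c m \<in> carrier_mat 2 2"
  by (simp add: upper_triangular_2_def)

text \<open>Two intertwiners give the diagonal of the value: the first unit vector as a column
  coming from \<open>l\<close>, the second unit vector as a row leading to \<open>m\<close>. The
  corner of the square is then the corner of the value times the sum of the diagonal entries, and it
  has to equal \<open>c\<close>.\<close>

lemma nc_sqrt_upper_triangular_2:
  assumes f: "nc_function 1 D f" and sq: "\<And>y. y \<in> D \<Longrightarrow> f y * f y = y ! 0"
    and l: "scalar_point l \<in> D" and m: "scalar_point m \<in> D" and M: "[upper_triangular_2 l c m] \<in> D"
  shows "f [upper_triangular_2 l c m] $$ (0, 1) * (f (scalar_point l) $$ (0, 0) + f (scalar_point m) $$ (0, 0)) = c"
proof -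
  let ?M = "upper_triangular_2 l c m"
  let ?F = "f [?M]"
  have F: "?F \<in> carrier_mat 2 2" by (rule nc_function_carrier[OF f M]) simp
  have fm: "f (scalar_point m) \<in> carrier_mat 1 1" by (rule nc_function_carrier[OF f m]) simp
  have sum2: "(\<Sum>k\<in>{0..<2::nat}. h k) = h 0 + h 1" for h :: "nat \<Rightarrow> complex"
    by (simp add: numeral_2_eq_2)
  have "?M *\<^sub>v unit_vec 2 0 = l \<cdot>\<^sub>v unit_vec 2 0"
    by (intro eq_vecI) (auto simp: upper_triangular_2_def scalar_prod_def sum2 less_2_cases_iff)
  then have "?F *\<^sub>v unit_vec 2 0 = f (scalar_point l) $$ (0, 0) \<cdot>\<^sub>v unit_vec 2 0"
    by (intro nc_function_eigenvector[OF f M, of 2]) (auto simp: l)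
  then have "(?F *\<^sub>v unit_vec 2 0) $ 0 = (f (scalar_point l) $$ (0, 0) \<cdot>\<^sub>v unit_vec 2 0) $ 0" by simp
  then have F00: "?F $$ (0, 0) = f (scalar_point l) $$ (0, 0)" using F by simp
  let ?L = "mat 1 2 (\<lambda>(i, j). if j = 0 then 0 else 1) :: complex mat"
  have "?L * ?M = mat (Suc 0) (Suc 0) (\<lambda>_. m) * ?L"
    by (intro eq_matI) (auto simp: upper_triangular_2_def scalar_prod_def sum2 less_2_cases_iff)
  then have "?L * ?F = f (scalar_point m) * ?L"
    by (intro nc_function_intertwines[OF f M _ m, of 2 1]) auto
  then have "(?L * ?F) $$ (0, 1) = (f (scalar_point m) * ?L) $$ (0, 1)" by simp
  then have F11: "?F $$ (1, 1) = f (scalar_point m) $$ (0, 0)"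
    using F fm by (simp add: scalar_prod_def sum2)
  have "(?F * ?F) $$ (0, 1) = c"
    using sq[OF M] by (simp add: upper_triangular_2_def)
  then have "?F $$ (0, 0) * ?F $$ (0, 1) + ?F $$ (0, 1) * ?F $$ (1, 1) = c"
    using F by (simp add: scalar_prod_def sum2)
  then show ?thesis unfolding F00 F11 by (simp add: algebra_simps)
qed

lemma nc_sqrts_not_opposite_near:
  assumes \<delta>: "free_poly_mat 1 \<delta>" and W: "W = basic_free_set 1 \<delta>"
    and f: "nc_function 1 W f" and fsq: "\<And>y. y \<in> W \<Longrightarrow> f y * f y = y ! 0"
    and g: "nc_function 1 W g" and gsq: "\<And>y. y \<in> W \<Longrightarrow> g y * g y = y ! 0"
    and bd: "\<And>y. y \<in> W \<Longrightarrow> mat_op_norm (f y) \<le> C" "\<And>y. y \<in> W \<Longrightarrow> mat_op_norm (g y) \<le> C"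
    and e: "scalar_point e \<in> W" "f (scalar_point e) $$ (0, 0) = g (scalar_point e) $$ (0, 0)"
  obtains r where "0 < r"
    "\<And>m. scalar_point m \<in> W \<Longrightarrow> cmod (m - e) < r \<Longrightarrow>
       f (scalar_point m) $$ (0, 0) \<noteq> - g (scalar_point m) $$ (0, 0)"
proof -
  let ?M = "\<lambda>q :: complex \<times> complex. upper_triangular_2 e (fst q) (snd q)"
  let ?E = "mat (Suc 0) (Suc 0) (\<lambda>_. e)"
  have "nc_dsum [?E] [?E] \<in> W"
    using nc_set_basic_free_set[OF _ \<delta>] e(1) W by (simp add: nc_set_def)
  moreover have "mat_dsum ?E ?E = ?M (0, e)"
    by (intro eq_matI) (auto simp: mat_dsum_def upper_triangular_2_def)
  ultimately have mem: "[?M (0, e)] \<in> W" by (simp add: nc_dsum_def)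
  \<comment> \<open>The direct sum of \<open>e\<close> with itself is the triangular matrix with
    corner 0. The product filter then provides separate radii for the corner and for
    \<open>m\<close>, so a nonzero corner stays available however close \<open>m\<close> is to
    \<open>e\<close>.\<close>
  have "eventually (\<lambda>q. [?M q] \<in> basic_free_set 1 \<delta>) (nhds 0 \<times>\<^sub>F nhds e)"
  proof (rule eventually_mem_basic_free_set[OF _ _ _ \<delta>])
    have lim: "(fst \<longlongrightarrow> (0::complex)) (nhds 0 \<times>\<^sub>F nhds e)" "(snd \<longlongrightarrow> e) (nhds (0::complex) \<times>\<^sub>F nhds e)"
      by (simp_all add: filterlim_def filtermap_fst_prod_filter filtermap_snd_prod_filter)
    fix i j :: nat assume "i < 2" "j < 2"
    then show "((\<lambda>q. ?M q $$ (i, j)) \<longlongrightarrow> ?M (0, e) $$ (i, j)) (nhds 0 \<times>\<^sub>F nhds e)"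
      using lim by (auto simp: upper_triangular_2_def less_2_cases_iff)
  qed (use mem W in auto)
  then obtain P Q where P: "eventually P (nhds 0)" and Q: "eventually Q (nhds e)"
    and PQ: "\<And>c m. P c \<Longrightarrow> Q m \<Longrightarrow> [upper_triangular_2 e c m] \<in> W"
    unfolding eventually_prod_filter W by auto
  obtain d where d: "0 < d" and dP: "\<And>c. dist c 0 < d \<Longrightarrow> P c"
    using P unfolding eventually_nhds_metric by blast
  obtain d' where d': "0 < d'" and dQ: "\<And>m. dist m e < d' \<Longrightarrow> Q m"
    using Q unfolding eventually_nhds_metric by blast
  \<comment> \<open>With corner \<open>d / 2\<close> the bound \<open>C\<close> on both values gives
    \<open>d\<^sup>2 / 4 \<le> C\<^sup>2 * cmod (e - m)\<close>. The second entry of the minimum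
    contradicts this, where \<open>+ 1\<close> covers \<open>C = 0\<close>; the first keeps the
    triangular matrix in \<open>W\<close>.\<close>
  define r where "r = min d' (d\<^sup>2 / (4 * (C\<^sup>2 + 1)))"
  have C1: "0 < C\<^sup>2 + 1" by (simp add: add_nonneg_pos)
  have "0 < r" using d d' C1 by (simp add: r_def)
  moreover have "f (scalar_point m) $$ (0, 0) \<noteq> - g (scalar_point m) $$ (0, 0)"
    if m: "scalar_point m \<in> W" and close: "cmod (m - e) < r" for m
  proof
    assume opp: "f (scalar_point m) $$ (0, 0) = - g (scalar_point m) $$ (0, 0)"
    define c where "c = complex_of_real (d / 2)"
    have c: "cmod c = d / 2" using d by (simp add: c_def)
    let ?T = "upper_triangular_2 e c m"
    have T: "[?T] \<in> W"
      using c d close by (intro PQ dP dQ) (simp_all add: r_def dist_norm)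
    define \<alpha> \<beta> where "\<alpha> = f (scalar_point e) $$ (0, 0)" and "\<beta> = f (scalar_point m) $$ (0, 0)"
    have fT: "f [?T] $$ (0, 1) * (\<alpha> + \<beta>) = c"
      using nc_sqrt_upper_triangular_2[OF f fsq e(1) m T] by (simp add: \<alpha>_def \<beta>_def)
    have gT: "g [?T] $$ (0, 1) * (\<alpha> - \<beta>) = c"
      using nc_sqrt_upper_triangular_2[OF g gsq e(1) m T] e(2) opp by (simp add: \<alpha>_def \<beta>_def)
    have square: "(f (scalar_point z) $$ (0, 0))\<^sup>2 = z" if z: "scalar_point z \<in> W" for z
    proof -
      have "f (scalar_point z) \<in> carrier_mat 1 1" by (rule nc_function_carrier[OF f z]) simp
      moreover have "(f (scalar_point z) * f (scalar_point z)) $$ (0, 0) = z"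
        by (simp add: fsq[OF z])
      ultimately show ?thesis by (simp add: scalar_prod_def power2_eq_square)
    qed
    \<comment> \<open>Neither \<open>\<alpha> + \<beta>\<close> nor
      \<open>\<alpha> - \<beta>\<close> is known to be small, but their product is
      \<open>e - m\<close>; this is why \<open>f\<close> and \<open>g\<close> are evaluated at the
      same triangular matrix.\<close>
    have "c\<^sup>2 = f [?T] $$ (0, 1) * g [?T] $$ (0, 1) * (\<alpha>\<^sup>2 - \<beta>\<^sup>2)"
    proof -
      have "c\<^sup>2 = (f [?T] $$ (0, 1) * (\<alpha> + \<beta>)) * (g [?T] $$ (0, 1) * (\<alpha> - \<beta>))"
        by (simp only: fT gT power2_eq_square)
      then show ?thesis by (simp add: power2_eq_square algebra_simps)
    qed
    also have "\<alpha>\<^sup>2 - \<beta>\<^sup>2 = e - m" using square[OF e(1)] square[OF m] by (simp add: \<alpha>_def \<beta>_def)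
    finally have "(cmod c)\<^sup>2 = cmod (f [?T] $$ (0, 1)) * cmod (g [?T] $$ (0, 1)) * cmod (e - m)"
      by (metis norm_mult norm_power)
    also have "\<dots> \<le> C * C * cmod (e - m)"
    proof (intro mult_right_mono mult_mono)
      have car: "f [?T] \<in> carrier_mat 2 2" "g [?T] \<in> carrier_mat 2 2"
        using nc_function_carrier(1)[OF f T] nc_function_carrier(1)[OF g T] by simp_all
      show 1: "cmod (f [?T] $$ (0, 1)) \<le> C"
        using cmod_index_le_mat_op_norm[of 0 "f [?T]" 1] bd(1)[OF T] car by simp
      show "cmod (g [?T] $$ (0, 1)) \<le> C"
        using cmod_index_le_mat_op_norm[of 0 "g [?T]" 1] bd(2)[OF T] car by simp
      show "0 \<le> C" using 1 norm_ge_zero order_trans by blast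
    qed simp_all
    also have "\<dots> \<le> C\<^sup>2 * r"
      using close by (simp add: power2_eq_square norm_minus_commute mult_left_mono)
    also have "\<dots> \<le> C\<^sup>2 * (d\<^sup>2 / (4 * (C\<^sup>2 + 1)))" by (intro mult_left_mono) (auto simp: r_def)
    also have "\<dots> = (d\<^sup>2 / 4) * (C\<^sup>2 / (C\<^sup>2 + 1))" by simp
    also have "\<dots> < (d\<^sup>2 / 4) * 1"
      using d C1 by (intro mult_strict_left_mono) simp_all
    finally show False by (simp add: c power_divide)
  qed
  ultimately show ?thesis using that by blast
qed

section \<open>Local agreement of square roots\<close>

lemma nc_sqrts_opposite_eigenvalue:
  assumes \<delta>: "free_poly_mat 1 \<delta>" and W: "W = basic_free_set 1 \<delta>"
    and f: "nc_function 1 W f" and fsq: "\<And>y. y \<in> W \<Longrightarrow> f y * f y = y ! 0"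
    and g: "nc_function 1 W g" and gsq: "\<And>y. y \<in> W \<Longrightarrow> g y * g y = y ! 0"
    and A: "[A] \<in> W" "A \<in> carrier_mat n n" and ne: "f [A] \<noteq> g [A]"
  obtains m where "eigenvalue A m" "f (scalar_point m) $$ (0, 0) = - g (scalar_point m) $$ (0, 0)"
proof -
  let ?F = "f [A]" and ?G = "g [A]"
  have F: "?F \<in> carrier_mat n n" and G: "?G \<in> carrier_mat n n"
    using nc_function_carrier(1)[OF f A] nc_function_carrier(1)[OF g A] by simp_all
  have FF: "?F * ?F = A" and GG: "?G * ?G = A" using fsq[OF A(1)] gsq[OF A(1)] by simp_all
  have FA: "?F * A = A * ?F" using assoc_mult_mat[OF F F F] FF by simp
  have GA: "?G * A = A * ?G" using assoc_mult_mat[OF G G G] GG by simp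
  \<comment> \<open>\<open>?G\<close> commutes with its square \<open>A\<close>, hence intertwines
    \<open>A\<close> with itself, and the nc-function \<open>f\<close> respects this.\<close>
  have GF: "?G * ?F = ?F * ?G" by (rule nc_function_intertwines[OF f A A G GA])
  let ?S = "?F + ?G" and ?D = "?F - ?G"
  have S: "?S \<in> carrier_mat n n" and D: "?D \<in> carrier_mat n n" using F G by (simp_all add: minus_carrier_mat)
  have "?S * ?D = (?F * ?F - ?F * ?G) + (?G * ?F - ?G * ?G)"
    unfolding add_mult_distrib_mat[OF F G D] mult_minus_distrib_mat[OF F F G] mult_minus_distrib_mat[OF G F G] ..
  also have "\<dots> = 0\<^sub>m n n" unfolding FF GG GF using F G A(2) by (intro eq_matI) auto
  finally have SD: "?S * ?D = 0\<^sub>m n n" .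
  obtain i j where ij: "i < n" "j < n" "?F $$ (i, j) \<noteq> ?G $$ (i, j)"
    using ne F G by (metis carrier_matD eq_matI)
  \<comment> \<open>All columns of \<open>?D\<close> lie in the kernel of \<open>?S\<close>, and the
    column through an entry at which the two values differ is nonzero.\<close>
  define u where "u = col ?D j"
  have u: "u \<in> carrier_vec n" using D ij by (simp add: u_def)
  have "u $ i \<noteq> 0" using ij F G by (simp add: u_def)
  then have u0: "u \<noteq> 0\<^sub>v n" using ij by auto
  have "?S *\<^sub>v u = col (?S * ?D) j" using S D ij by (simp add: u_def col_mult2[of _ n n _ n])
  then have Su: "?S *\<^sub>v u = 0\<^sub>v n" using ij by (simp add: SD)
  have AS: "?S * A = A * ?S"
    using F G A(2) FA GA by (simp add: add_mult_distrib_mat[of _ n n] mult_add_distrib_mat[of _ n n])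
  have inv: "?S *\<^sub>v (A *\<^sub>v w - a \<cdot>\<^sub>v w) = 0\<^sub>v n" if w: "w \<in> carrier_vec n" "?S *\<^sub>v w = 0\<^sub>v n" for w a
  proof -
    have "?S *\<^sub>v (A *\<^sub>v w - a \<cdot>\<^sub>v w) = ?S *\<^sub>v (A *\<^sub>v w) - a \<cdot>\<^sub>v (?S *\<^sub>v w)"
      using S A(2) w by (simp add: mult_minus_distrib_mat_vec[of _ n n] mult_mat_vec[of _ n n])
    also have "?S *\<^sub>v (A *\<^sub>v w) = A *\<^sub>v (?S *\<^sub>v w)"
      using S A(2) w(1) AS by (metis assoc_mult_mat_vec)
    finally show ?thesis unfolding w(2) using A(2) by (intro eq_vecI) auto
  qed
  obtain w m where w: "w \<in> carrier_vec n" "w \<noteq> 0\<^sub>v n" "A *\<^sub>v w = m \<cdot>\<^sub>v w" "?S *\<^sub>v w = 0\<^sub>v n"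
    using exists_eigenvector_in_invariant[of A n u "\<lambda>w. ?S *\<^sub>v w = 0\<^sub>v n", OF A(2) u u0 Su inv] by blast
  have m: "scalar_point m \<in> W"
    unfolding W by (rule scalar_point_mem_basic_free_set[OF A(2) _ \<delta> w(1-3)]) (use A W in simp)
  obtain k where k: "k < n" "w $ k \<noteq> 0"
    using w(1,2) by (metis carrier_vecD eq_vecI index_zero_vec)
  have "?S *\<^sub>v w = ?F *\<^sub>v w + ?G *\<^sub>v w" using F G w(1) by (rule add_mult_distrib_mat_vec)
  then have "?F *\<^sub>v w + ?G *\<^sub>v w = 0\<^sub>v n" using w(4) by simp
  then have "(f (scalar_point m) $$ (0, 0) \<cdot>\<^sub>v w + g (scalar_point m) $$ (0, 0) \<cdot>\<^sub>v w) $ k = 0"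
    using nc_function_eigenvector[OF f A w(1,3) m] nc_function_eigenvector[OF g A w(1,3) m] k(1) by simp
  then have "(f (scalar_point m) $$ (0, 0) + g (scalar_point m) $$ (0, 0)) * w $ k = 0"
    using k(1) w(1) by (simp add: distrib_right)
  then have "f (scalar_point m) $$ (0, 0) = - g (scalar_point m) $$ (0, 0)"
    using k(2) by (simp add: add_eq_0_iff2)
  moreover have "eigenvalue A m"
    using w A(2) unfolding eigenvalue_def eigenvector_def by (intro exI[of _ w]) simp
  ultimately show ?thesis using that by blast
qed

text \<open>The set for \<open>\<gamma>\<close> confines the eigenvalues of \<open>y\<close> to
  small discs around the eigenvalues of \<open>x\<close>, and \<open>W\<close> contains the
  corresponding scalar points. An eigenvalue with opposite signs, which a disagreement at
  \<open>y\<close> would produce, is then excluded by the radius of its disc. The witness combines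
  \<open>\<delta>\<close> and \<open>\<gamma>\<close> so that both constraints hold at once.\<close>

lemma nc_sqrts_agree_near:
  assumes \<delta>: "free_poly_mat 1 \<delta>" and W: "W = basic_free_set 1 \<delta>"
    and f: "nc_function 1 W f" and fsq: "\<And>y. y \<in> W \<Longrightarrow> f y * f y = y ! 0"
    and g: "nc_function 1 W g" and gsq: "\<And>y. y \<in> W \<Longrightarrow> g y * g y = y ! 0"
    and bd: "\<And>y. y \<in> W \<Longrightarrow> mat_op_norm (f y) \<le> C" "\<And>y. y \<in> W \<Longrightarrow> mat_op_norm (g y) \<le> C"
    and x: "x \<in> W" "f x = g x"
  obtains \<gamma> where "free_poly_mat 1 \<gamma>" "x \<in> basic_free_set 1 \<gamma>" "basic_free_set 1 \<gamma> \<subseteq> W"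
    "\<And>y. y \<in> basic_free_set 1 \<gamma> \<Longrightarrow> f y = g y"
proof -
  have uni: "W \<subseteq> nc_universe 1" using W by (auto simp: basic_free_set_def)
  obtain A n where xA: "x = [A]" and A: "A \<in> carrier_mat n n" "0 < n"
    using nc_universe_1E uni x(1) by (metis subsetD)
  have AW: "[A] \<in> W" using x(1) xA by simp
  have eig: "scalar_point m \<in> W"
    if BW: "[B] \<in> W" and B: "B \<in> carrier_mat k k" and ev: "eigenvalue B m" for B k m
  proof -
    obtain v where v: "v \<in> carrier_vec k" "v \<noteq> 0\<^sub>v k" "B *\<^sub>v v = m \<cdot>\<^sub>v v"
      using B ev unfolding eigenvalue_def eigenvector_def by auto
    then show ?thesis
      unfolding W using scalar_point_mem_basic_free_set[OF B _ \<delta> v] BW W by simp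
  qed
  have "\<exists>r. 0 < r \<and> (\<forall>m. scalar_point m \<in> W \<longrightarrow> cmod (m - e) < r \<longrightarrow>
       f (scalar_point m) $$ (0, 0) \<noteq> - g (scalar_point m) $$ (0, 0))" if e: "eigenvalue A e" for e
  proof -
    have eW: "scalar_point e \<in> W" by (rule eig[OF AW A(1) e])
    obtain v where v: "v \<in> carrier_vec n" "v \<noteq> 0\<^sub>v n" "A *\<^sub>v v = e \<cdot>\<^sub>v v"
      using e A(1) unfolding eigenvalue_def eigenvector_def by auto
    obtain k where k: "k < n" "v $ k \<noteq> 0"
      using v(1,2) by (metis carrier_vecD eq_vecI index_zero_vec)
    have "f (scalar_point e) $$ (0, 0) \<cdot>\<^sub>v v = g (scalar_point e) $$ (0, 0) \<cdot>\<^sub>v v"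
      using nc_function_eigenvector[OF f AW A(1) v(1,3) eW] nc_function_eigenvector[OF g AW A(1) v(1,3) eW]
        x(2) xA by simp
    then have "(f (scalar_point e) $$ (0, 0) \<cdot>\<^sub>v v) $ k = (g (scalar_point e) $$ (0, 0) \<cdot>\<^sub>v v) $ k" by simp
    then have "f (scalar_point e) $$ (0, 0) = g (scalar_point e) $$ (0, 0)" using k v(1) by simp
    then show ?thesis
      using nc_sqrts_not_opposite_near[OF \<delta> W f fsq g gsq bd eW] by metis
  qed
  then obtain r where r: "\<And>e. eigenvalue A e \<Longrightarrow> 0 < r e"
    "\<And>e m. eigenvalue A e \<Longrightarrow> scalar_point m \<in> W \<Longrightarrow> cmod (m - e) < r e \<Longrightarrow>
       f (scalar_point m) $$ (0, 0) \<noteq> - g (scalar_point m) $$ (0, 0)"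
    by metis
  obtain \<gamma> where \<gamma>: "free_poly_mat 1 \<gamma>" "[A] \<in> basic_free_set 1 \<gamma>"
    and close: "\<And>m. scalar_point m \<in> basic_free_set 1 \<gamma> \<Longrightarrow> \<exists>e. eigenvalue A e \<and> cmod (m - e) < r e"
    by (rule exists_basic_free_set_eigenvalues[OF A, of r]) (use r(1) in blast)+
  have Int: "basic_free_set 1 (poly_mat_dsum \<delta> \<gamma>) = W \<inter> basic_free_set 1 \<gamma>"
    unfolding W by (rule basic_free_set_poly_mat_dsum) simp
  have "f y = g y" if y: "y \<in> W \<inter> basic_free_set 1 \<gamma>" for y
  proof (rule ccontr)
    assume ne: "f y \<noteq> g y"
    obtain B k where yB: "y = [B]" and B: "B \<in> carrier_mat k k"
      using nc_universe_1E uni y by (metis IntD1 subsetD)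
    have BW: "[B] \<in> W" and B\<gamma>: "[B] \<in> basic_free_set 1 \<gamma>" using y yB by simp_all
    obtain m where m: "eigenvalue B m" "f (scalar_point m) $$ (0, 0) = - g (scalar_point m) $$ (0, 0)"
      using nc_sqrts_opposite_eigenvalue[OF \<delta> W f fsq g gsq BW B] ne yB by metis
    obtain v where v: "v \<in> carrier_vec k" "v \<noteq> 0\<^sub>v k" "B *\<^sub>v v = m \<cdot>\<^sub>v v"
      using m(1) B unfolding eigenvalue_def eigenvector_def by auto
    have "scalar_point m \<in> basic_free_set 1 \<gamma>"
      by (rule scalar_point_mem_basic_free_set[OF B B\<gamma> \<gamma>(1) v])
    then obtain e where e: "eigenvalue A e" "cmod (m - e) < r e" using close by blast
    then show False using r(2)[OF e(1) eig[OF BW B m(1)] e(2)] m(2) by simp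
  qed
  moreover have "free_poly_mat 1 (poly_mat_dsum \<delta> \<gamma>)" by (rule free_poly_mat_poly_mat_dsum[OF \<delta> \<gamma>(1)])
  ultimately show ?thesis
    using that[of "poly_mat_dsum \<delta> \<gamma>"] Int x(1) xA \<gamma>(2) by simp
qed

section \<open>Branches and the topology of the surface\<close>

lemma one_pos: "0 < (1::nat)"
  by simp

lemma openin_free_topologyE:
  assumes "openin (free_topology 1) W" "x \<in> W"
  obtains \<delta> where "free_poly_mat 1 \<delta>" "x \<in> basic_free_set 1 \<delta>" "basic_free_set 1 \<delta> \<subseteq> W"
  using bspec[OF iffD1[OF openin_free_topology[OF one_pos] assms(1)] assms(2)] that by (elim exE conjE)

text \<open>The neighbourhood that carries the bound is merely open, so its intersection with the nc
  neighbourhood may fail to be an nc-set. The conclusion therefore speaks of the nc-subsets of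
  \<open>W\<close>, such as the basic free sets inside it.\<close>

lemma freely_holomorphic_locally_bounded_nc:
  assumes f: "freely_holomorphic 1 U f" and x: "x \<in> U"
  obtains W C where "openin (free_topology 1) W" "x \<in> W" "W \<subseteq> U"
    "\<And>D. nc_set 1 D \<Longrightarrow> D \<subseteq> W \<Longrightarrow> nc_function 1 D f" "\<And>y. y \<in> W \<Longrightarrow> mat_op_norm (f y) \<le> C"
proof -
  obtain U' V C where "openin (free_topology 1) U'" "x \<in> U'" "U' \<subseteq> U" "nc_function 1 U' f"
    "openin (free_topology 1) V" "x \<in> V" "V \<subseteq> U" "\<forall>y\<in>V. mat_op_norm (f y) \<le> C"
    using f x unfolding freely_holomorphic_def by blast
  then show ?thesis
    using that[of "U' \<inter> V" C] nc_function_subset[of 1 U' f] by (simp add: openin_Int le_infI1)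
qed

text \<open>Branches are nc-functions and bounded only locally, so both are first cut down to one
  basic free set on which each is an nc-function and a common bound holds.\<close>

lemma sqrt_branches_agree_near:
  assumes f: "(f, U) \<in> sqrt_branches" and g: "(g, V) \<in> sqrt_branches"
    and x: "x \<in> U" "x \<in> V" "f x = g x"
  obtains \<gamma> where "free_poly_mat 1 \<gamma>" "x \<in> basic_free_set 1 \<gamma>" "basic_free_set 1 \<gamma> \<subseteq> U \<inter> V"
    "\<And>y. y \<in> basic_free_set 1 \<gamma> \<Longrightarrow> f y = g y"
proof -
  have hol: "freely_holomorphic 1 U f" "freely_holomorphic 1 V g"
    and sq: "\<And>y. y \<in> U \<Longrightarrow> f y * f y = y ! 0" "\<And>y. y \<in> V \<Longrightarrow> g y * g y = y ! 0"
    using f g by (simp_all add: sqrt_branches_def)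
  obtain Wf Cf where Wf: "openin (free_topology 1) Wf" "x \<in> Wf" "Wf \<subseteq> U"
    "\<And>D. nc_set 1 D \<Longrightarrow> D \<subseteq> Wf \<Longrightarrow> nc_function 1 D f" "\<And>y. y \<in> Wf \<Longrightarrow> mat_op_norm (f y) \<le> Cf"
    using freely_holomorphic_locally_bounded_nc[OF hol(1) x(1)] by metis
  obtain Wg Cg where Wg: "openin (free_topology 1) Wg" "x \<in> Wg" "Wg \<subseteq> V"
    "\<And>D. nc_set 1 D \<Longrightarrow> D \<subseteq> Wg \<Longrightarrow> nc_function 1 D g" "\<And>y. y \<in> Wg \<Longrightarrow> mat_op_norm (g y) \<le> Cg"
    using freely_holomorphic_locally_bounded_nc[OF hol(2) x(2)] by metis
  have "openin (free_topology 1) (Wf \<inter> Wg)" using Wf(1) Wg(1) by (rule openin_Int)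
  then obtain \<delta> where \<delta>: "free_poly_mat 1 \<delta>" "x \<in> basic_free_set 1 \<delta>" "basic_free_set 1 \<delta> \<subseteq> Wf \<inter> Wg"
    by (rule openin_free_topologyE) (use Wf(2) Wg(2) in blast)
  define W where "W = basic_free_set 1 \<delta>"
  have nc: "nc_set 1 W" unfolding W_def by (rule nc_set_basic_free_set[OF _ \<delta>(1)]) simp
  have sub: "W \<subseteq> Wf" "W \<subseteq> Wg" using \<delta>(3) by (simp_all add: W_def)
  have xW: "x \<in> W" using \<delta>(2) by (simp add: W_def)
  have fW: "nc_function 1 W f" and gW: "nc_function 1 W g" using Wf(4) Wg(4) nc sub by simp_all
  have fsq: "f y * f y = y ! 0" and gsq: "g y * g y = y ! 0"
    and bf: "mat_op_norm (f y) \<le> max Cf Cg" and bg: "mat_op_norm (g y) \<le> max Cf Cg" if "y \<in> W" for y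
    using that sub Wf(3) Wg(3) sq Wf(5)[of y] Wg(5)[of y] by (auto simp: subset_iff le_max_iff_disj)
  obtain \<gamma> where "free_poly_mat 1 \<gamma>" "x \<in> basic_free_set 1 \<gamma>" "basic_free_set 1 \<gamma> \<subseteq> W"
    "\<And>y. y \<in> basic_free_set 1 \<gamma> \<Longrightarrow> f y = g y"
    using nc_sqrts_agree_near[OF \<delta>(1) W_def fW fsq gW gsq bf bg xW x(3)] by metis
  then show ?thesis using that sub Wf(3) Wg(3) by blast
qed

text \<open>Since \<open>D\<close> is an nc-set, cutting an nc neighbourhood down to
  \<open>D\<close> leaves an nc-set.\<close>

lemma freely_holomorphic_subset:
  assumes f: "freely_holomorphic 1 U f" and D: "openin (free_topology 1) D" "nc_set 1 D" "D \<subseteq> U"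
  shows "freely_holomorphic 1 D f"
  unfolding freely_holomorphic_def
proof (intro conjI ballI)
  show "graded 1 D f" using f D(3) unfolding freely_holomorphic_def graded_def by blast
  fix x assume x: "x \<in> D"
  obtain U' where U': "openin (free_topology 1) U'" "x \<in> U'" "nc_function 1 U' f"
    using f x D(3) unfolding freely_holomorphic_def by blast
  have "nc_set 1 (U' \<inter> D)" using U'(3) D(2) unfolding nc_function_def nc_set_def by blast
  then have "nc_function 1 (U' \<inter> D) f" by (rule nc_function_subset[OF U'(3)]) simp
  then show "\<exists>V. openin (free_topology 1) V \<and> x \<in> V \<and> V \<subseteq> D \<and> nc_function 1 V f"
    using openin_Int[OF U'(1) D(1)] U'(2) x by (intro exI[of _ "U' \<inter> D"]) simp
  obtain V C where V: "openin (free_topology 1) V" "x \<in> V" "\<forall>y\<in>V. mat_op_norm (f y) \<le> C"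
    using f x D(3) unfolding freely_holomorphic_def by blast
  then show "\<exists>V. openin (free_topology 1) V \<and> x \<in> V \<and> V \<subseteq> D \<and> (\<exists>C. \<forall>y\<in>V. mat_op_norm (f y) \<le> C)"
    using openin_Int[OF V(1) D(1)] x by (intro exI[of _ "V \<inter> D"]) auto
qed fact

lemma sqrt_branches_subset:
  assumes f: "(f, U) \<in> sqrt_branches" and \<gamma>: "free_poly_mat 1 \<gamma>" "basic_free_set 1 \<gamma> \<subseteq> U"
  shows "(f, basic_free_set 1 \<gamma>) \<in> sqrt_branches"
proof -
  have "freely_holomorphic 1 (basic_free_set 1 \<gamma>) f"
    by (rule freely_holomorphic_subset[of U])
      (use f \<gamma> in \<open>simp_all add: sqrt_branches_def openin_basic_free_set nc_set_basic_free_set\<close>)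
  then show ?thesis using f \<gamma> unfolding sqrt_branches_def by blast
qed

text \<open>The base condition is where local agreement enters: two graphs meet only above points
  where the branches agree, and the graph over a small basic free set around such a point lies in
  both.\<close>

lemma openin_sqrt_topology:
  "openin sqrt_topology W \<longleftrightarrow>
    (\<forall>p\<in>W. \<exists>(f, U)\<in>sqrt_branches. p \<in> graph_on f U \<and> graph_on f U \<subseteq> W)"
proof -
  let ?\<B> = "{graph_on f U |f U. (f, U) \<in> sqrt_branches}"
  have "openin sqrt_topology W \<longleftrightarrow> (\<forall>p\<in>W. \<exists>B\<in>?\<B>. p \<in> B \<and> B \<subseteq> W)"
    unfolding sqrt_topology_def
  proof (rule openin_topology_with_base)
    fix S T p assume "S \<in> ?\<B>" "T \<in> ?\<B>" and p: "p \<in> S \<inter> T"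
    then obtain f U g V where f: "(f, U) \<in> sqrt_branches" "S = graph_on f U"
      and g: "(g, V) \<in> sqrt_branches" "T = graph_on g V" by blast
    obtain x where x: "x \<in> U" "x \<in> V" "f x = g x" "p = (x, f x)"
      using p f(2) g(2) by (auto simp: graph_on_def)
    obtain \<gamma> where \<gamma>: "free_poly_mat 1 \<gamma>" "x \<in> basic_free_set 1 \<gamma>" "basic_free_set 1 \<gamma> \<subseteq> U \<inter> V"
      "\<And>y. y \<in> basic_free_set 1 \<gamma> \<Longrightarrow> f y = g y"
      using sqrt_branches_agree_near[OF f(1) g(1) x(1-3)] by metis
    have "(f, basic_free_set 1 \<gamma>) \<in> sqrt_branches"
      using sqrt_branches_subset[OF f(1) \<gamma>(1)] \<gamma>(3) by simp
    then have "graph_on f (basic_free_set 1 \<gamma>) \<in> ?\<B>" by blast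
    moreover have "p \<in> graph_on f (basic_free_set 1 \<gamma>)" using x(4) \<gamma>(2) by (auto simp: graph_on_def)
    moreover have "graph_on f (basic_free_set 1 \<gamma>) \<subseteq> S \<inter> T"
    proof
      fix q assume "q \<in> graph_on f (basic_free_set 1 \<gamma>)"
      then obtain y where y: "y \<in> basic_free_set 1 \<gamma>" "q = (y, f y)" by (auto simp: graph_on_def)
      then show "q \<in> S \<inter> T"
        using \<gamma>(3) \<gamma>(4)[OF y(1)] unfolding f(2) g(2) graph_on_def by auto
    qed
    ultimately show "\<exists>B\<in>?\<B>. p \<in> B \<and> B \<subseteq> S \<inter> T"
      by (intro bexI[of _ "graph_on f (basic_free_set 1 \<gamma>)"] conjI)
  qed
  moreover have "(\<exists>B\<in>?\<B>. P B) \<longleftrightarrow> (\<exists>(f, U)\<in>sqrt_branches. P (graph_on f U))" for P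
    by (auto simp: Bex_def)
  ultimately show ?thesis by (simp only:)
qed

lemma topspace_sqrt_topology: "topspace sqrt_topology = sqrt_surface"
proof
  show "topspace sqrt_topology \<subseteq> sqrt_surface"
    using openin_topspace[of sqrt_topology] unfolding openin_sqrt_topology sqrt_surface_def by blast
  have "openin sqrt_topology sqrt_surface"
    unfolding openin_sqrt_topology sqrt_surface_def by blast
  then show "sqrt_surface \<subseteq> topspace sqrt_topology" by (rule openin_subset)
qed

lemma openin_graph_on:
  assumes f: "(f, U) \<in> sqrt_branches" and W: "openin (free_topology 1) W" "W \<subseteq> U"
  shows "openin sqrt_topology (graph_on f W)"
  unfolding openin_sqrt_topology
proof
  fix p assume "p \<in> graph_on f W"
  then obtain x where x: "x \<in> W" "p = (x, f x)" by (auto simp: graph_on_def)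
  then obtain \<gamma> where \<gamma>: "free_poly_mat 1 \<gamma>" "x \<in> basic_free_set 1 \<gamma>" "basic_free_set 1 \<gamma> \<subseteq> W"
    using openin_free_topologyE[OF W(1)] by metis
  have "(f, basic_free_set 1 \<gamma>) \<in> sqrt_branches"
    using sqrt_branches_subset[OF f \<gamma>(1)] \<gamma>(3) W(2) by simp
  moreover have "p \<in> graph_on f (basic_free_set 1 \<gamma>)" "graph_on f (basic_free_set 1 \<gamma>) \<subseteq> graph_on f W"
    using x \<gamma>(2,3) by (auto simp: graph_on_def)
  ultimately show "\<exists>(h, V)\<in>sqrt_branches. p \<in> graph_on h V \<and> graph_on h V \<subseteq> graph_on f W"
    by blast
qed

text \<open>Every member of the base projects onto a basic free set. Besides the openness of the
  charts, this gives the openness of the chart overlaps.\<close>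

lemma openin_fst_image:
  assumes W: "openin sqrt_topology W"
  shows "openin (free_topology 1) (fst ` W)"
  unfolding openin_free_topology[OF one_pos]
proof
  fix x assume "x \<in> fst ` W"
  then obtain p where p: "p \<in> W" "x = fst p" by blast
  then obtain f U where f: "(f, U) \<in> sqrt_branches" "p \<in> graph_on f U" "graph_on f U \<subseteq> W"
    using W unfolding openin_sqrt_topology by blast
  obtain \<delta> where "free_poly_mat 1 \<delta>" "U = basic_free_set 1 \<delta>"
    using f(1) by (auto simp: sqrt_branches_def)
  moreover have "x \<in> U" using f(2) p(2) by (auto simp: graph_on_def)
  moreover have "U \<subseteq> fst ` W" using f(3) by (force simp: graph_on_def)
  ultimately show "\<exists>\<delta>. free_poly_mat 1 \<delta> \<and> x \<in> basic_free_set 1 \<delta> \<and> basic_free_set 1 \<delta> \<subseteq> fst ` W" by blast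
qed

lemma sqrt_branches_domain:
  assumes "(f, U) \<in> sqrt_branches"
  shows "openin (free_topology 1) U" "nc_set 1 U"
  using assms by (auto simp: sqrt_branches_def intro: openin_basic_free_set nc_set_basic_free_set)

text \<open>A graph is a section of the projection, which gives bijectivity. Openness is
  \<open>openin_fst_image\<close>, and continuity holds because the part of the graph above an open
  set is open by \<open>openin_graph_on\<close>.\<close>

lemma homeomorphic_map_graph_on:
  assumes f: "(f, U) \<in> sqrt_branches"
  shows "homeomorphic_map (subtopology sqrt_topology (graph_on f U)) (subtopology (free_topology 1) U) fst"
proof (rule bijective_open_imp_homeomorphic_map)
  have U: "openin (free_topology 1) U" by (rule sqrt_branches_domain[OF f])
  have G: "openin sqrt_topology (graph_on f U)" by (rule openin_graph_on[OF f U order_refl])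
  have top: "topspace (subtopology sqrt_topology (graph_on f U)) = graph_on f U"
    "topspace (subtopology (free_topology 1) U) = U"
    using openin_subset[OF G] openin_subset[OF U] by (auto simp: topspace_subtopology)
  show img: "fst ` topspace (subtopology sqrt_topology (graph_on f U)) = topspace (subtopology (free_topology 1) U)"
    unfolding top by (force simp: graph_on_def)
  show "inj_on fst (topspace (subtopology sqrt_topology (graph_on f U)))"
    unfolding top by (auto simp: graph_on_def inj_on_def)
  show "open_map (subtopology sqrt_topology (graph_on f U)) (subtopology (free_topology 1) U) fst"
    unfolding open_map_def openin_open_subtopology[OF G] openin_open_subtopology[OF U]
    using openin_fst_image by (auto simp: graph_on_def)
  show "continuous_map (subtopology sqrt_topology (graph_on f U)) (subtopology (free_topology 1) U) fst"
    unfolding continuous_map_def top openin_open_subtopology[OF G] openin_open_subtopology[OF U]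
  proof (intro conjI allI impI)
    show "fst \<in> graph_on f U \<rightarrow> U" by (auto simp: graph_on_def)
    fix W assume W: "openin (free_topology 1) W \<and> W \<subseteq> U"
    then have "{p \<in> graph_on f U. fst p \<in> W} = graph_on f W" by (auto simp: graph_on_def)
    then show "openin sqrt_topology {p \<in> graph_on f U. fst p \<in> W}"
      using openin_graph_on[OF f] W by simp
  qed auto
qed

section \<open>Transition maps and the manifold axioms\<close>

lemma nc_function_nth_0:
  assumes "nc_set 1 C"
  shows "nc_function 1 C (\<lambda>x. x ! 0)"
  unfolding nc_function_def
proof (intro conjI ballI allI impI)
  show "graded 1 C (\<lambda>x. x ! 0)" using nth_nc_level[of _ 1 _ 0] by (auto simp: graded_def)
  have len: "length x = 1" if "x \<in> C" for x
    using assms that by (auto simp: nc_set_def nc_universe_def nc_level_def)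
  show "nc_dsum x y ! 0 = mat_dsum (x ! 0) (y ! 0)" if "x \<in> C" "y \<in> C" for x y
    using len[OF that(1)] len[OF that(2)] by (simp add: nc_dsum_def)
  show "map (\<lambda>a. t * a * s) x ! 0 = t * (x ! 0) * s" if "x \<in> C \<inter> nc_level 1 n" for n x s t
    using that len[of x] by simp
qed fact

lemma nc_function_cong:
  assumes "nc_function d C f" "\<And>x. x \<in> C \<Longrightarrow> g x = f x"
  shows "nc_function d C g"
  using assms unfolding nc_function_def graded_def nc_set_def by simp

theorem theorem6p14:
  shows "free_manifold 1 sqrt_surface sqrt_topology sqrt_atlas"
  unfolding free_manifold_def
proof (intro conjI)
  show "topspace sqrt_topology = sqrt_surface" by (rule topspace_sqrt_topology)
  show "(\<Union>(U, \<alpha>, D)\<in>sqrt_atlas. U) = sqrt_surface"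
    by (auto simp: sqrt_atlas_def sqrt_surface_def)
  show "\<forall>(U, \<alpha>, D)\<in>sqrt_atlas. openin sqrt_topology U \<and> openin (free_topology 1) D \<and> nc_set 1 D \<and>
      homeomorphic_map (subtopology sqrt_topology U) (subtopology (free_topology 1) D) \<alpha>"
    using sqrt_branches_domain openin_graph_on[OF _ _ order_refl] homeomorphic_map_graph_on
    by (auto simp: sqrt_atlas_def)
  \<comment> \<open>All charts are restrictions of \<open>fst\<close>, so a transition map is the
    identity on the overlap, whichever branches are involved.\<close>
  have transition: "(\<exists>\<C>. (\<forall>C\<in>\<C>. nc_set 1 C) \<and> \<Union>\<C> = fst ` (graph_on f U \<inter> graph_on g V)) \<and>
        (\<forall>C. nc_set 1 C \<and> C \<subseteq> fst ` (graph_on f U \<inter> graph_on g V) \<longrightarrow>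
           nc_mapping 1 1 C V (fst \<circ> inv_into (graph_on f U) fst))"
    if f: "(f, U) \<in> sqrt_branches" and g: "(g, V) \<in> sqrt_branches" for f U g V
  proof (intro conjI allI impI)
    let ?E = "fst ` (graph_on f U \<inter> graph_on g V)"
    \<comment> \<open>The overlap consists of the points where the two branches agree. Branches are
      only required to respect direct sums locally, so the overlap is exhausted by basic free sets
      inside it instead of being treated as one nc-set.\<close>
    have open_E: "openin (free_topology 1) ?E"
      using openin_graph_on[OF f _ order_refl] openin_graph_on[OF g _ order_refl] sqrt_branches_domain f g
      by (intro openin_fst_image openin_Int) blast+
    show "\<exists>\<C>. (\<forall>C\<in>\<C>. nc_set 1 C) \<and> \<Union>\<C> = ?E"
    proof (intro exI conjI)
      let ?\<C> = "{C. nc_set 1 C \<and> C \<subseteq> ?E}"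
      show "\<forall>C\<in>?\<C>. nc_set 1 C" by blast
      show "\<Union>?\<C> = ?E"
      proof (intro equalityI subsetI)
        fix x assume "x \<in> ?E"
        then obtain \<delta> where \<delta>: "free_poly_mat 1 \<delta>" "x \<in> basic_free_set 1 \<delta>" "basic_free_set 1 \<delta> \<subseteq> ?E"
          by (rule openin_free_topologyE[OF open_E])
        have "basic_free_set 1 \<delta> \<in> ?\<C>" using nc_set_basic_free_set[OF one_pos \<delta>(1)] \<delta>(3) by simp
        then show "x \<in> \<Union>?\<C>" using \<delta>(2) by (rule UnionI)
      qed blast
    qed
    fix C assume C: "nc_set 1 C \<and> C \<subseteq> ?E"
    \<comment> \<open>\<open>inv_into\<close> selects a point of the graph above \<open>x\<close>,
      and \<open>fst\<close> leads back to \<open>x\<close>.\<close>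
    have id: "(fst \<circ> inv_into (graph_on f U) fst) x = x" if "x \<in> C" for x
      using that C f_inv_into_f[of x fst "graph_on f U"] by auto
    have "C \<subseteq> V" using C by (auto simp: graph_on_def)
    then have "(fst \<circ> inv_into (graph_on f U) fst) ` C \<subseteq> V" using id by auto
    moreover have "nc_function 1 C (\<lambda>x. (fst \<circ> inv_into (graph_on f U) fst) x ! i)" if "i < 1" for i
      using that id by (intro nc_function_cong[OF nc_function_nth_0]) (use C in auto)
    ultimately show "nc_mapping 1 1 C V (fst \<circ> inv_into (graph_on f U) fst)"
      unfolding nc_mapping_def using C sqrt_branches_domain(2)[OF g] by blast
  qed
  show "\<forall>(U, \<alpha>, D)\<in>sqrt_atlas. \<forall>(V, \<beta>, E)\<in>sqrt_atlas.
        (\<exists>\<C>. (\<forall>C\<in>\<C>. nc_set 1 C) \<and> \<Union>\<C> = \<alpha> ` (U \<inter> V)) \<and>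
        (\<forall>C. nc_set 1 C \<and> C \<subseteq> \<alpha> ` (U \<inter> V) \<longrightarrow> nc_mapping 1 1 C E (\<beta> \<circ> inv_into U \<alpha>))"
  proof (rule ballI)
    fix p assume "p \<in> sqrt_atlas"
    then obtain f U where f: "(f, U) \<in> sqrt_branches" and p: "p = (graph_on f U, fst, U)"
      by (auto simp: sqrt_atlas_def)
    show "case p of (U, \<alpha>, D) \<Rightarrow> \<forall>(V, \<beta>, E)\<in>sqrt_atlas.
        (\<exists>\<C>. (\<forall>C\<in>\<C>. nc_set 1 C) \<and> \<Union>\<C> = \<alpha> ` (U \<inter> V)) \<and>
        (\<forall>C. nc_set 1 C \<and> C \<subseteq> \<alpha> ` (U \<inter> V) \<longrightarrow> nc_mapping 1 1 C E (\<beta> \<circ> inv_into U \<alpha>))"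
      unfolding p prod.case
    proof (rule ballI)
      fix q assume "q \<in> sqrt_atlas"
      then obtain g V where g: "(g, V) \<in> sqrt_branches" and q: "q = (graph_on g V, fst, V)"
        by (auto simp: sqrt_atlas_def)
      show "case q of (V, \<beta>, E) \<Rightarrow>
        (\<exists>\<C>. (\<forall>C\<in>\<C>. nc_set 1 C) \<and> \<Union>\<C> = fst ` (graph_on f U \<inter> V)) \<and>
        (\<forall>C. nc_set 1 C \<and> C \<subseteq> fst ` (graph_on f U \<inter> V) \<longrightarrow>
           nc_mapping 1 1 C E (\<beta> \<circ> inv_into (graph_on f U) fst))"
        unfolding q prod.case by (rule transition[OF f g])
    qed
  qed
qed simp

end
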